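(* Let $1\le p<\infty$ and let $(X,\mathcal B,\mu,f,T_f)$ be a composition dynamical system, with $T_f:L^p(X)\to L^p(X)$, $T_f(\varphi)=\varphi\circ f$. The composition operator $T_f$ is $\mathbb R$-supercyclic if and only if for every $\epsilon>0$ and every $B\in\mathcal B$ of finite measure there exist a measurable set $B'\subseteq B$, an integer $k\ge 1$ and a real number $\lambda>0$ such that \[ \mu(B\setminus B')<\epsilon,\qquad \mu(f^{k}(B'))<\lambda^{p}\epsilon\qquad\text{and}\qquad \mu(f^{-k}(B'))<\lambda^{-p}\epsilon . \]
   Context: Setting: $X$ is a locally compact, $\sigma$-compact, second countable Hausdorff space, $\mathcal B$ is the Borel $\sigma$-algebra of $X$, and $\mu$ is a locally finite Borel measure on $X$ (hence $\sigma$-finite). The map $f:X\to X$ is bijective and bimeasurable (both $f$ and $f^{-1}$ are measurable), and the Radon-Nikodym derivatives of $\mu\circ f$ and of $\mu\circ f^{-1}$ with respect to $\mu$ exist and are bounded from below (by a positive constant). Then $T_f(\varphi)=\varphi\circ f$ is a well-defined bounded invertible linear operator on the space $L^p(X)=L^p(X,\mathcal B,\mu)$ of complex-valued functions, called a composition operator, and the quintuple $(X,\mathcal B,\mu,f,T_f)$ is called a composition dynamical system. A bounded linear operator $T$ on a separable Banach space $E$ is $\mathbb R$-supercyclic if there is $x\in E$ such that $\{\lambda T^n x: n\ge 0,\ \lambda\in\mathbb R\}$ is dense in $E$. *)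

theory Defs
  imports "HOL-Analysis.Analysis"
begin

section \<open>The spaces \<open>L\<^sup>p(M)\<close> of complex-valued functions\<close>

definition Lp_functions :: "real \<Rightarrow> 'a measure \<Rightarrow> ('a \<Rightarrow> complex) set" where
  "Lp_functions p M =
     {\<phi> \<in> borel_measurable M. integrable M (\<lambda>x. norm (\<phi> x) powr p)}"

definition Lp_rel :: "real \<Rightarrow> 'a measure \<Rightarrow> (('a \<Rightarrow> complex) \<times> ('a \<Rightarrow> complex)) set" where
  "Lp_rel p M =
     {(\<phi>, \<psi>). \<phi> \<in> Lp_functions p M \<and> \<psi> \<in> Lp_functions p M \<and> (AE x in M. \<phi> x = \<psi> x)}"

definition Lp :: "real \<Rightarrow> 'a measure \<Rightarrow> ('a \<Rightarrow> complex) set set" where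
  "Lp p M = Lp_functions p M // Lp_rel p M"

definition Lp_class :: "real \<Rightarrow> 'a measure \<Rightarrow> ('a \<Rightarrow> complex) \<Rightarrow> ('a \<Rightarrow> complex) set" where
  "Lp_class p M \<phi> = Lp_rel p M `` {\<phi>}"

text \<open>The operations on classes below are defined through an arbitrary representative; for \<open>p \<ge> 1\<close>
  they do not depend on it (for \<open>Lp_comp\<close> because the preimage of a null set
  is a null set in a composition dynamical system).\<close>

definition Lp_rep :: "('a \<Rightarrow> complex) set \<Rightarrow> 'a \<Rightarrow> complex" where
  "Lp_rep a = (SOME \<phi>. \<phi> \<in> a)"

definition Lp_norm :: "real \<Rightarrow> 'a measure \<Rightarrow> ('a \<Rightarrow> complex) \<Rightarrow> real" where
  "Lp_norm p M \<phi> = (\<integral>x. norm (\<phi> x) powr p \<partial>M) powr (1 / p)"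

definition Lp_dist ::
    "real \<Rightarrow> 'a measure \<Rightarrow> ('a \<Rightarrow> complex) set \<Rightarrow> ('a \<Rightarrow> complex) set \<Rightarrow> real" where
  "Lp_dist p M a b = Lp_norm p M (\<lambda>x. Lp_rep a x - Lp_rep b x)"

definition Lp_scaleR ::
    "real \<Rightarrow> 'a measure \<Rightarrow> real \<Rightarrow> ('a \<Rightarrow> complex) set \<Rightarrow> ('a \<Rightarrow> complex) set" where
  "Lp_scaleR p M r a = Lp_class p M (\<lambda>x. r *\<^sub>R Lp_rep a x)"

definition Lp_comp ::
    "real \<Rightarrow> 'a measure \<Rightarrow> ('a \<Rightarrow> 'a) \<Rightarrow> ('a \<Rightarrow> complex) set \<Rightarrow> ('a \<Rightarrow> complex) set" where
  "Lp_comp p M f a = Lp_class p M (Lp_rep a \<circ> f)"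


section \<open>Real supercyclicity\<close>

text \<open>\<open>E\<close> is the carrier of a normed space with induced metric \<open>d\<close> and multiplication by real
  scalars \<open>smul\<close>, and \<open>T\<close> is an operator on \<open>E\<close>.\<close>

definition real_supercyclic ::
    "'v set \<Rightarrow> ('v \<Rightarrow> 'v \<Rightarrow> real) \<Rightarrow> (real \<Rightarrow> 'v \<Rightarrow> 'v) \<Rightarrow> ('v \<Rightarrow> 'v) \<Rightarrow> bool" where
  "real_supercyclic E d smul T \<longleftrightarrow>
     (\<exists>x\<in>E. Metric_space.mtopology E d closure_of {smul r ((T ^^ n) x) | n r. True} = E)"


section \<open>Composition dynamical systems\<close>

text \<open>The Radon-Nikodym derivative \<open>dN/dM\<close> exists and is bounded below by a positive constant; as it
  is determined only almost everywhere, so is the bound.  The first conjunct is the existence: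
  \<open>RN_deriv M N\<close> is a junk value unless \<open>N\<close> has a density with respect to \<open>M\<close>.\<close>

definition RN_deriv_bounded_below :: "'a measure \<Rightarrow> 'a measure \<Rightarrow> bool" where
  "RN_deriv_bounded_below M N \<longleftrightarrow>
     density M (RN_deriv M N) = N \<and>
     (\<exists>c::real. c > 0 \<and> (AE x in M. ennreal c \<le> RN_deriv M N x))"

text \<open>\<open>\<mu> \<circ> f\<close> is the measure \<open>A \<mapsto> \<mu> (f ` A)\<close>, which is the image of \<open>\<mu>\<close> under \<open>inv f\<close>;
  likewise \<open>\<mu> \<circ> f\<^sup>-\<^sup>1\<close> is the image of \<open>\<mu>\<close> under \<open>f\<close>.\<close>

locale composition_dynamical_system =
  fixes M :: "'a :: {second_countable_topology, t2_space} measure"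
    and f :: "'a \<Rightarrow> 'a"
  assumes locally_compact: "locally_compact_space (euclidean :: 'a topology)"
    and sigma_compact: "\<exists>K :: nat \<Rightarrow> 'a set. (\<forall>n. compact (K n)) \<and> (\<Union>n. K n) = UNIV"
    and sets_M: "sets M = sets borel"
    and locally_finite: "\<And>x. \<exists>U. open U \<and> x \<in> U \<and> emeasure M U < \<infinity>"
    and bij_f: "bij f"
    and measurable_f: "f \<in> measurable M M"
    and measurable_inv_f: "inv f \<in> measurable M M"
    and RN_comp_f: "RN_deriv_bounded_below M (distr M M (inv f))"
    and RN_comp_inv_f: "RN_deriv_bounded_below M (distr M M f)"


section \<open>The notions above are well defined\<close>

lemma powr_conv:
  fixes x y s t p :: real
  assumes p: "1 \<le> p" and "0 \<le> x" "0 \<le> y" "0 \<le> s" "0 \<le> t" "s + t = 1"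
  shows "(s * x + t * y) powr p \<le> s * x powr p + t * y powr p"
proof -
  have small: "(r * z) powr p \<le> r * z powr p" if "0 \<le> r" "r \<le> 1" "0 \<le> z" for r z :: real
  proof -
    have "r powr p \<le> r" 
      using powr_le_one_le[of r p] that p by (cases "r = 0") auto
    then show ?thesis using that by (simp add: powr_mult mult_right_mono)
  qed
  consider "x = 0" | "y = 0" | "x > 0" "y > 0" using assms by linarith
  then show ?thesis
  proof cases
    case 1 then show ?thesis using small[of t y] assms by simp
  next
    case 2 then show ?thesis using small[of s x] assms by simp
  next
    case 3
    have s: "s = 1 - t" using assms by simp
    show ?thesis
      using convex_onD[OF powr_convex[OF p], of t x y] 3 assms unfolding s by simp
  qed
qed

lemma Lp_functions_measurable: "\<phi> \<in> Lp_functions p M \<Longrightarrow> \<phi> \<in> borel_measurable M"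
  and Lp_functions_integrable: "\<phi> \<in> Lp_functions p M \<Longrightarrow> integrable M (\<lambda>x. norm (\<phi> x) powr p)"
  by (auto simp: Lp_functions_def)

lemma Lp_functions_scaleR:
  assumes "\<phi> \<in> Lp_functions p M"
  shows "(\<lambda>x. r *\<^sub>R \<phi> x) \<in> Lp_functions p M"
proof -
  have "norm (r *\<^sub>R \<phi> x) powr p = \<bar>r\<bar> powr p * norm (\<phi> x) powr p" for x
    by (simp add: powr_mult)
  moreover have "(\<lambda>x. r *\<^sub>R \<phi> x) \<in> borel_measurable M"
    using Lp_functions_measurable[OF assms] by measurable
  ultimately show ?thesis using assms by (simp add: Lp_functions_def)
qed

lemma Lp_functions_diff:
  assumes p: "1 \<le> p" and f: "\<phi> \<in> Lp_functions p M" and g: "\<psi> \<in> Lp_functions p M"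
  shows "(\<lambda>x. \<phi> x - \<psi> x) \<in> Lp_functions p M"
proof -
  have [measurable]: "\<phi> \<in> borel_measurable M" "\<psi> \<in> borel_measurable M"
    using f g by (auto simp: Lp_functions_def)
  have "norm (\<phi> x - \<psi> x) powr p \<le> 2 powr p * (norm (\<phi> x) powr p + norm (\<psi> x) powr p)" for x
  proof -
    have "norm (\<phi> x - \<psi> x) powr p \<le> (norm (\<phi> x) + norm (\<psi> x)) powr p"
      using p by (intro powr_mono2) (auto intro: norm_triangle_ineq4)
    also have "... \<le> (2 * max (norm (\<phi> x)) (norm (\<psi> x))) powr p"
      using p by (intro powr_mono2) auto
    also have "... = 2 powr p * max (norm (\<phi> x)) (norm (\<psi> x)) powr p"
      by (simp add: powr_mult)
    also have "... \<le> 2 powr p * (norm (\<phi> x) powr p + norm (\<psi> x) powr p)"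
      by (intro mult_left_mono) (auto simp: max_def)
    finally show ?thesis .
  qed
  then have "integrable M (\<lambda>x. norm (\<phi> x - \<psi> x) powr p)"
    by (intro Bochner_Integration.integrable_bound[where g = "\<lambda>x. norm (\<phi> x - \<psi> x) powr p" and
        f = "\<lambda>x. 2 powr p * (norm (\<phi> x) powr p + norm (\<psi> x) powr p)"])
      (use f g in \<open>auto simp: Lp_functions_def\<close>)
  then show ?thesis by (simp add: Lp_functions_def)
qed

lemma Lp_norm_eq_0_iff:
  assumes p: "1 \<le> p" and f: "\<phi> \<in> Lp_functions p M"
  shows "Lp_norm p M \<phi> = 0 \<longleftrightarrow> (AE x in M. \<phi> x = 0)"
  using integral_nonneg_eq_0_iff_AE[OF Lp_functions_integrable[OF f]] p
  by (simp add: Lp_norm_def)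

lemma Lp_norm_nonneg: "0 \<le> Lp_norm p M \<phi>"
  by (simp add: Lp_norm_def)

lemma Lp_norm_powr:
  assumes p: "1 \<le> p"
  shows "Lp_norm p M \<phi> powr p = (\<integral>x. norm (\<phi> x) powr p \<partial>M)"
  using p by (simp add: Lp_norm_def powr_powr)

lemma Lp_norm_cong_AE:
  assumes "AE x in M. norm (\<phi> x) = norm (\<psi> x)" "\<phi> \<in> borel_measurable M" "\<psi> \<in> borel_measurable M"
  shows "Lp_norm p M \<phi> = Lp_norm p M \<psi>"
proof -
  have "(\<integral>x. norm (\<phi> x) powr p \<partial>M) = (\<integral>x. norm (\<psi> x) powr p \<partial>M)"
    by (rule integral_cong_AE) (use assms in \<open>auto elim: eventually_mono\<close>)
  then show ?thesis by (simp add: Lp_norm_def)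
qed

lemma Lp_norm_diff_triangle:
  assumes p: "1 \<le> p" and f: "\<phi> \<in> Lp_functions p M" and g: "\<psi> \<in> Lp_functions p M"
  shows "Lp_norm p M (\<lambda>x. \<phi> x - \<psi> x) \<le> Lp_norm p M \<phi> + Lp_norm p M \<psi>"
proof -
  have [measurable]: "\<phi> \<in> borel_measurable M" "\<psi> \<in> borel_measurable M"
    using f g by (auto simp: Lp_functions_def)
  define a b where "a = Lp_norm p M \<phi>" and "b = Lp_norm p M \<psi>"
  have ab: "0 \<le> a" "0 \<le> b" by (auto simp: a_def b_def Lp_norm_nonneg)
  consider "a = 0" | "b = 0" | "a > 0" "b > 0" using ab by linarith
  then show ?thesis
  proof cases
    case 1
    then have "AE x in M. \<phi> x = 0" using Lp_norm_eq_0_iff[OF p f] by (simp add: a_def)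
    then have "Lp_norm p M (\<lambda>x. \<phi> x - \<psi> x) = Lp_norm p M \<psi>"
      by (intro Lp_norm_cong_AE) (auto elim: eventually_mono)
    then show ?thesis using ab by (simp add: a_def)
  next
    case 2
    then have "AE x in M. \<psi> x = 0" using Lp_norm_eq_0_iff[OF p g] by (simp add: b_def)
    then have "Lp_norm p M (\<lambda>x. \<phi> x - \<psi> x) = Lp_norm p M \<phi>"
      by (intro Lp_norm_cong_AE) (auto elim: eventually_mono)
    then show ?thesis using ab by (simp add: b_def)
  next
    case 3
    define s t where "s = a / (a + b)" and "t = b / (a + b)"
    have st: "0 \<le> s" "0 \<le> t" "s + t = 1"
      using 3 by (auto simp: s_def t_def add_divide_distrib[symmetric])
    define h where "h = (\<lambda>x. (a + b) powr p *
      (s / a powr p * norm (\<phi> x) powr p + t / b powr p * norm (\<psi> x) powr p))"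
    have *: "norm (\<phi> x - \<psi> x) powr p \<le> h x" for x
    proof -
      have "norm (\<phi> x - \<psi> x) powr p \<le> (norm (\<phi> x) + norm (\<psi> x)) powr p"
        using p by (intro powr_mono2) (auto intro: norm_triangle_ineq4)
      also have "norm (\<phi> x) + norm (\<psi> x) =
          (a + b) * (s * (norm (\<phi> x) / a) + t * (norm (\<psi> x) / b))"
        using 3 by (simp add: s_def t_def distrib_left)
      also have "... powr p = (a + b) powr p * (s * (norm (\<phi> x) / a) + t * (norm (\<psi> x) / b)) powr p"
        using 3 st by (simp add: powr_mult)
      also have "... \<le> (a + b) powr p * (s * (norm (\<phi> x) / a) powr p + t * (norm (\<psi> x) / b) powr p)"
        using 3 st p by (intro mult_left_mono powr_conv) auto
      also have "... = h x"
        using 3 by (simp add: h_def powr_divide)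
      finally show ?thesis .
    qed
    have int: "integrable M (\<lambda>x. norm (\<phi> x) powr p)" "integrable M (\<lambda>x. norm (\<psi> x) powr p)"
      using f g by (auto simp: Lp_functions_integrable)
    have "(\<integral>x. norm (\<phi> x - \<psi> x) powr p \<partial>M) \<le> (\<integral>x. h x \<partial>M)"
    proof (rule integral_mono)
      show "integrable M (\<lambda>x. norm (\<phi> x - \<psi> x) powr p)"
        using Lp_functions_integrable[OF Lp_functions_diff[OF p f g]] .
      show "integrable M h" unfolding h_def using int by simp
    qed (rule *)
    also have "... = (a + b) powr p * (s / a powr p * a powr p + t / b powr p * b powr p)"
      using int Lp_norm_powr[OF p, of M \<phi>] Lp_norm_powr[OF p, of M \<psi>]
      by (simp add: h_def a_def b_def)
    also have "... = (a + b) powr p"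
      using 3 st by simp
    finally have "Lp_norm p M (\<lambda>x. \<phi> x - \<psi> x) \<le> ((a + b) powr p) powr (1 / p)"
      unfolding Lp_norm_def using p by (intro powr_mono2) auto
    also have "... = a + b" using 3 p by (simp add: powr_powr)
    finally show ?thesis by (simp add: a_def b_def)
  qed
qed

lemma equiv_Lp_rel: "equiv (Lp_functions p M) (Lp_rel p M)"
  by (intro equivI refl_onI symI transI) (auto simp: Lp_rel_def elim: AE_mp)

lemma Lp_class_in_Lp: "\<phi> \<in> Lp_functions p M \<Longrightarrow> Lp_class p M \<phi> \<in> Lp p M"
  by (simp add: Lp_class_def Lp_def quotientI)

lemma Lp_rep:
  assumes "a \<in> Lp p M"
  shows "Lp_rep a \<in> Lp_functions p M" "Lp_class p M (Lp_rep a) = a"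
proof -
  have "a \<noteq> {}" using assms equiv_Lp_rel unfolding Lp_def by (metis in_quotient_imp_non_empty)
  then have in_a: "Lp_rep a \<in> a" unfolding Lp_rep_def by (simp add: some_in_eq)
  then show "Lp_rep a \<in> Lp_functions p M"
    using assms equiv_Lp_rel[of p M] unfolding Lp_def by (meson in_quotient_imp_subset subsetD)
  show "Lp_class p M (Lp_rep a) = a"
    using in_a assms equiv_Lp_rel[of p M] unfolding Lp_def Lp_class_def
    by (metis Image_singleton_iff equiv_class_eq quotientE)
qed

lemma Lp_class_eq_iff:
  assumes "\<phi> \<in> Lp_functions p M" "\<psi> \<in> Lp_functions p M"
  shows "Lp_class p M \<phi> = Lp_class p M \<psi> \<longleftrightarrow> (AE x in M. \<phi> x = \<psi> x)"
  using eq_equiv_class_iff[OF equiv_Lp_rel assms] assms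
  by (simp add: Lp_class_def Lp_rel_def)

lemma Metric_space_Lp:
  assumes p: "1 \<le> p"
  shows "Metric_space (Lp p M) (Lp_dist p M)"
proof
  fix a b c
  show "0 \<le> Lp_dist p M a b" by (simp add: Lp_dist_def Lp_norm_nonneg)
  show "Lp_dist p M a b = Lp_dist p M b a" by (simp add: Lp_dist_def Lp_norm_def norm_minus_commute)
  assume a: "a \<in> Lp p M" and b: "b \<in> Lp p M"
  note ra = Lp_rep[OF a] and rb = Lp_rep[OF b]
  have "Lp_dist p M a b = 0 \<longleftrightarrow> (AE x in M. Lp_rep a x = Lp_rep b x)"
    using Lp_norm_eq_0_iff[OF p Lp_functions_diff[OF p ra(1) rb(1)]] by (simp add: Lp_dist_def)
  also have "... \<longleftrightarrow> a = b" using Lp_class_eq_iff[OF ra(1) rb(1)] ra rb by simp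
  finally show "Lp_dist p M a b = 0 \<longleftrightarrow> a = b" .
  assume c: "c \<in> Lp p M"
  note rc = Lp_rep[OF c]
  have "Lp_dist p M a c = Lp_norm p M (\<lambda>x. (Lp_rep a x - Lp_rep b x) - (Lp_rep c x - Lp_rep b x))"
    by (simp add: Lp_dist_def)
  also have "... \<le> Lp_norm p M (\<lambda>x. Lp_rep a x - Lp_rep b x) + Lp_norm p M (\<lambda>x. Lp_rep c x - Lp_rep b x)"
    by (intro Lp_norm_diff_triangle Lp_functions_diff p ra rb rc)
  finally show "Lp_dist p M a c \<le> Lp_dist p M a b + Lp_dist p M b c"
    by (simp add: Lp_dist_def Lp_norm_def norm_minus_commute)
qed

lemma Lp_dist_class:
  assumes p: "1 \<le> p" and f: "\<phi> \<in> Lp_functions p M" and g: "\<psi> \<in> Lp_functions p M"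
  shows "Lp_dist p M (Lp_class p M \<phi>) (Lp_class p M \<psi>) = Lp_norm p M (\<lambda>x. \<phi> x - \<psi> x)"
proof -
  let ?u = "Lp_rep (Lp_class p M \<phi>)" and ?v = "Lp_rep (Lp_class p M \<psi>)"
  have uv: "?u \<in> Lp_functions p M" "?v \<in> Lp_functions p M"
    "AE x in M. ?u x = \<phi> x" "AE x in M. ?v x = \<psi> x"
    using Lp_rep[OF Lp_class_in_Lp[OF f]] Lp_rep[OF Lp_class_in_Lp[OF g]] Lp_class_eq_iff f g by metis+
  have "AE x in M. norm (?u x - ?v x) = norm (\<phi> x - \<psi> x)"
    using uv(3,4) by eventually_elim simp
  then show ?thesis unfolding Lp_dist_def
    by (intro Lp_norm_cong_AE) (use f g uv in \<open>auto simp: Lp_functions_def\<close>)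
qed

lemma Lp_scaleR_class:
  assumes f: "\<phi> \<in> Lp_functions p M"
  shows "Lp_scaleR p M r (Lp_class p M \<phi>) = Lp_class p M (\<lambda>x. r *\<^sub>R \<phi> x)"
proof -
  let ?u = "Lp_rep (Lp_class p M \<phi>)"
  have u: "?u \<in> Lp_functions p M" "AE x in M. ?u x = \<phi> x"
    using Lp_rep[OF Lp_class_in_Lp[OF f]] Lp_class_eq_iff f by metis+
  show ?thesis unfolding Lp_scaleR_def
    using u(2) by (subst Lp_class_eq_iff) (auto simp: Lp_functions_scaleR u f elim: eventually_mono)
qed

context composition_dynamical_system
begin

lemma distr_f_le: "\<exists>C>0. \<forall>A\<in>sets M. emeasure M (f -` A) \<le> ennreal C * emeasure M A"
proof -
  have sp: "space M = UNIV" using sets_eq_imp_space_eq[OF sets_M] by simp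
  let ?D = "RN_deriv M (distr M M (inv f))"
  obtain c :: real where c: "c > 0" "AE x in M. ennreal c \<le> ?D x"
    and d: "density M ?D = distr M M (inv f)"
    using RN_comp_f unfolding RN_deriv_bounded_below_def by blast
  have "emeasure M (f -` A) \<le> ennreal (1 / c) * emeasure M A" if A[measurable]: "A \<in> sets M" for A
  proof -
    have fA[measurable]: "f -` A \<in> sets M" using measurable_sets[OF measurable_f A] sp by simp
    have "ennreal c * emeasure M (f -` A) = (\<integral>\<^sup>+x. ennreal c * indicator (f -` A) x \<partial>M)"
      by (simp add: nn_integral_cmult_indicator)
    also have "... \<le> (\<integral>\<^sup>+x. ?D x * indicator (f -` A) x \<partial>M)"
      by (rule nn_integral_mono_AE) (use c(2) in \<open>auto elim!: eventually_mono simp: indicator_def\<close>)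
    also have "... = emeasure (density M ?D) (f -` A)"
      by (simp add: emeasure_density)
    also have "... = emeasure M (inv f -` (f -` A))"
      unfolding d by (subst emeasure_distr[OF measurable_inv_f]) (auto simp: sp)
    also have "inv f -` (f -` A) = A"
      using bij_f by (auto simp: bij_is_surj surj_f_inv_f)
    finally have "ennreal (1 / c) * (ennreal c * emeasure M (f -` A)) \<le> ennreal (1/c) * emeasure M A"
      by (intro mult_left_mono) auto
    then show ?thesis using c(1) by (simp add: mult.assoc[symmetric] ennreal_mult[symmetric])
  qed
  then show ?thesis using c(1) by (intro exI[of _ "1/c"]) auto
qed

lemma AE_comp: "AE x in M. P x \<Longrightarrow> AE x in M. P (f x)"
proof -
  assume "AE x in M. P x"
  then obtain N where N: "{x\<in>space M. \<not> P x} \<subseteq> N" "N \<in> null_sets M" by (auto elim: AE_E2 simp: eventually_ae_filter)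
  obtain C where "\<forall>A\<in>sets M. emeasure M (f -` A) \<le> ennreal C * emeasure M A" using distr_f_le by blast
  then have "emeasure M (f -` N) = 0" using N(2) by (fastforce simp: null_sets_def)
  moreover have sp: "space M = UNIV" using sets_eq_imp_space_eq[OF sets_M] by simp
  moreover have "f -` N \<in> sets M" using measurable_sets[OF measurable_f, of N] N(2) sp by auto
  ultimately show ?thesis using N(1) by (auto simp: eventually_ae_filter null_sets_def intro!: exI[of _ "f -` N"])
qed

lemma Lp_functions_comp:
  assumes g: "\<phi> \<in> Lp_functions p M" shows "\<phi> \<circ> f \<in> Lp_functions p M"
proof -
  note [measurable] = Lp_functions_measurable[OF g] measurable_f
  obtain C where C: "\<forall>A\<in>sets M. emeasure M (f -` A) \<le> ennreal C * emeasure M A" using distr_f_le by blast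
  have sp: "space M = UNIV" using sets_eq_imp_space_eq[OF sets_M] by simp
  have "(\<integral>\<^sup>+x. ennreal (norm (\<phi> (f x)) powr p) \<partial>M) = (\<integral>\<^sup>+x. ennreal (norm (\<phi> x) powr p) \<partial>distr M M f)"
    by (simp add: nn_integral_distr)
  also have "... \<le> (\<integral>\<^sup>+x. ennreal (norm (\<phi> x) powr p) \<partial>density M (\<lambda>_. ennreal C))"
    by (rule nn_integral_mono_measure)
       (use C in \<open>auto simp: le_measure emeasure_distr emeasure_density_const sp\<close>)
  also have "... = ennreal C * (\<integral>\<^sup>+x. ennreal (norm (\<phi> x) powr p) \<partial>M)"
    by (simp add: nn_integral_density nn_integral_cmult)
  also have "... < \<infinity>" using Lp_functions_integrable[OF g]
    by (simp add: integrable_iff_bounded ennreal_mult_less_top)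
  finally show ?thesis by (simp add: Lp_functions_def integrable_iff_bounded)
qed

lemma Lp_comp_class:
  assumes g: "\<phi> \<in> Lp_functions p M"
  shows "Lp_comp p M f (Lp_class p M \<phi>) = Lp_class p M (\<phi> \<circ> f)"
proof -
  let ?u = "Lp_rep (Lp_class p M \<phi>)"
  have u: "?u \<in> Lp_functions p M" "AE x in M. ?u x = \<phi> x"
    using Lp_rep[OF Lp_class_in_Lp[OF g]] Lp_class_eq_iff g by metis+
  show ?thesis unfolding Lp_comp_def
    using AE_comp[OF u(2)] by (subst Lp_class_eq_iff) (auto simp: Lp_functions_comp u g)
qed

end

end

theory Submission
  imports Defs
begin

text \<open>If \<open>T\<^sub>f\<close> is \<open>\<real>\<close>-supercyclic, a real multiple of some iterate of a single vector is close to the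
  indicator function of \<open>B\<close>, and another one is close to \<open>\<i>\<close> times it.  Multiplication by \<open>\<i>\<close> commutes
  with \<open>T\<^sub>f\<close>, so it does not matter which of the two iterates comes first: one obtains \<open>\<phi>\<close> close to the
  indicator of \<open>B\<close> with \<open>r T\<^sub>f\<^sup>k \<phi>\<close> close to \<open>\<plusminus>\<i>\<close> times it.  As \<open>r\<close> is real, the errors of these two
  approximations are bounded away from zero on \<open>f\<^sup>k B'\<close> and \<open>f\<^sup>-\<^sup>k B'\<close>, where \<open>B'\<close> is the part of \<open>B\<close> on
  which both are good, and Markov's inequality bounds the measures of these sets.

  Conversely, given simple functions \<open>\<phi>\<close>, \<open>\<psi>\<close> supported in \<open>B\<close>, let \<open>\<phi>'\<close>, \<open>\<psi>'\<close> be their restrictions to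
  \<open>B'\<close>.  Then \<open>w = \<phi>' + r\<^sup>-\<^sup>1 T\<^sub>f\<^sup>-\<^sup>k \<psi>'\<close> is close to \<open>\<phi>\<close> and \<open>r T\<^sub>f\<^sup>k w\<close> is close to \<open>\<psi>\<close>.  This
  transitivity yields a supercyclic vector by Baire's theorem, since \<open>L\<^sup>p\<close> is complete and separable.\<close>

section \<open>The norm of \<open>L\<^sup>p\<close>\<close>

lemma powr_powr_inverse:
  fixes x p :: real
  assumes "0 \<le> x" "p \<noteq> 0"
  shows "(x powr p) powr (1 / p) = x"
  using assms by (simp add: powr_powr)

lemma Lp_functions_uminus:
  "\<phi> \<in> Lp_functions p M \<Longrightarrow> (\<lambda>x. - \<phi> x) \<in> Lp_functions p M"
  by (simp add: Lp_functions_def)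

lemma Lp_functions_add:
  assumes "1 \<le> p" "\<phi> \<in> Lp_functions p M" "\<psi> \<in> Lp_functions p M"
  shows "(\<lambda>x. \<phi> x + \<psi> x) \<in> Lp_functions p M"
  using Lp_functions_diff[OF assms(1,2) Lp_functions_uminus[OF assms(3)]] by simp

lemma Lp_norm_uminus: "Lp_norm p M (\<lambda>x. - \<phi> x) = Lp_norm p M \<phi>"
  by (simp add: Lp_norm_def)

lemma Lp_norm_minus_commute: "Lp_norm p M (\<lambda>x. \<phi> x - \<psi> x) = Lp_norm p M (\<lambda>x. \<psi> x - \<phi> x)"
  by (simp add: Lp_norm_def norm_minus_commute)

lemma Lp_norm_triangle:
  assumes "1 \<le> p" "\<phi> \<in> Lp_functions p M" "\<psi> \<in> Lp_functions p M"
  shows "Lp_norm p M (\<lambda>x. \<phi> x + \<psi> x) \<le> Lp_norm p M \<phi> + Lp_norm p M \<psi>"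
  using Lp_norm_diff_triangle[OF assms(1,2) Lp_functions_uminus[OF assms(3)]]
  by (simp add: Lp_norm_uminus)

lemma Lp_norm_triangle_through:
  assumes "1 \<le> p" "\<phi> \<in> Lp_functions p M" "\<psi> \<in> Lp_functions p M" "\<theta> \<in> Lp_functions p M"
  shows "Lp_norm p M (\<lambda>x. \<phi> x - \<theta> x)
    \<le> Lp_norm p M (\<lambda>x. \<phi> x - \<psi> x) + Lp_norm p M (\<lambda>x. \<psi> x - \<theta> x)"
  using Lp_norm_triangle[OF assms(1) Lp_functions_diff[OF assms(1,2,3)]
      Lp_functions_diff[OF assms(1,3,4)]] by simp

lemma Lp_norm_scaleR:
  assumes "1 \<le> p"
  shows "Lp_norm p M (\<lambda>x. r *\<^sub>R \<phi> x) = \<bar>r\<bar> * Lp_norm p M \<phi>"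
  using assms by (simp add: Lp_norm_def powr_mult powr_powr)

lemma Lp_functions_cmult:
  fixes c :: complex
  assumes "\<phi> \<in> Lp_functions p M"
  shows "(\<lambda>x. c * \<phi> x) \<in> Lp_functions p M"
proof -
  have "(\<lambda>x. c * \<phi> x) \<in> borel_measurable M"
    using Lp_functions_measurable[OF assms] by measurable
  then show ?thesis
    using assms by (simp add: Lp_functions_def norm_mult powr_mult)
qed

lemma Lp_norm_cmult:
  fixes c :: complex
  assumes "1 \<le> p"
  shows "Lp_norm p M (\<lambda>x. c * \<phi> x) = norm c * Lp_norm p M \<phi>"
  using assms by (simp add: Lp_norm_def norm_mult powr_mult powr_powr)

lemma nn_integral_eq_Lp_norm_powr:
  assumes "1 \<le> p" "\<phi> \<in> Lp_functions p M"
  shows "(\<integral>\<^sup>+x. ennreal (norm (\<phi> x) powr p) \<partial>M) = ennreal (Lp_norm p M \<phi> powr p)"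
  using Lp_functions_integrable[OF assms(2)]
  by (simp add: nn_integral_eq_integral Lp_norm_powr[OF assms(1)])

text \<open>Only measurability of \<open>\<phi>\<close> is assumed, so membership in
  \<open>Lp_functions\<close> and the norm bound come out together. This suits Fatou's lemma and
  changes of variables, which yield estimates for the nonnegative integral.\<close>

lemma Lp_norm_le_of_nn_integral:
  assumes p: "1 \<le> p" and [measurable]: "\<phi> \<in> borel_measurable M" and "0 \<le> e"
    and le: "(\<integral>\<^sup>+x. ennreal (norm (\<phi> x) powr p) \<partial>M) \<le> ennreal (e powr p)"
  shows "\<phi> \<in> Lp_functions p M" "Lp_norm p M \<phi> \<le> e"
proof -
  show Lp: "\<phi> \<in> Lp_functions p M"
    using le by (auto simp: Lp_functions_def integrable_iff_bounded intro: le_less_trans)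
  have "ennreal (Lp_norm p M \<phi> powr p) \<le> ennreal (e powr p)"
    using le nn_integral_eq_Lp_norm_powr[OF p Lp] by simp
  then have "Lp_norm p M \<phi> powr p \<le> e powr p" by simp
  then have "(Lp_norm p M \<phi> powr p) powr (1 / p) \<le> (e powr p) powr (1 / p)"
    by (rule powr_mono2[rotated 2]) (use p in auto)
  then show "Lp_norm p M \<phi> \<le> e"
    using p \<open>0 \<le> e\<close> by (simp add: powr_powr Lp_norm_nonneg)
qed

text \<open>Turns a small support into a small norm: \<open>norm (\<phi> x) powr p\<close> is
  dominated by \<open>C powr p\<close> times the indicator of \<open>S\<close>. The measure enters
  through a real bound \<open>e\<close>, whose root can then be taken.\<close>

lemma Lp_norm_bounded_support:
  assumes p: "1 \<le> p" and m: "\<phi> \<in> borel_measurable M" and S[measurable]: "S \<in> sets M"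
    and e: "emeasure M S \<le> ennreal e" "0 \<le> e"
    and bound: "\<And>x. x \<in> S \<Longrightarrow> norm (\<phi> x) \<le> C" and C: "0 \<le> C"
    and supp: "\<And>x. x \<in> space M \<Longrightarrow> x \<notin> S \<Longrightarrow> \<phi> x = 0"
  shows "\<phi> \<in> Lp_functions p M" "Lp_norm p M \<phi> \<le> C * e powr (1 / p)"
proof -
  have "(\<integral>\<^sup>+x. ennreal (norm (\<phi> x) powr p) \<partial>M) \<le> (\<integral>\<^sup>+x. ennreal (C powr p) * indicator S x \<partial>M)"
    using p bound supp by (intro nn_integral_mono) (auto simp: indicator_def powr_mono2)
  also have "\<dots> = ennreal (C powr p) * emeasure M S"
    by (simp add: nn_integral_cmult_indicator)
  also have "\<dots> \<le> ennreal (C powr p) * ennreal e"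
    by (intro mult_left_mono e) simp
  also have "\<dots> = ennreal ((C * e powr (1 / p)) powr p)"
    using p e C by (simp add: powr_mult powr_powr ennreal_mult)
  finally have *: "(\<integral>\<^sup>+x. ennreal (norm (\<phi> x) powr p) \<partial>M) \<le> ennreal ((C * e powr (1 / p)) powr p)" .
  show "\<phi> \<in> Lp_functions p M" "Lp_norm p M \<phi> \<le> C * e powr (1 / p)"
    using Lp_norm_le_of_nn_integral[OF p m _ *] C by simp_all
qed

text \<open>The opposite passage, from a small norm to a small set: \<open>c powr p\<close> times
  the indicator of \<open>S\<close> lies below \<open>norm (\<phi> x) powr p\<close>.\<close>

lemma Lp_Markov_inequality:
  assumes p: "1 \<le> p" and Lp: "\<phi> \<in> Lp_functions p M" and S[measurable]: "S \<in> sets M"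
    and c: "0 < c" and bound: "\<And>x. x \<in> S \<Longrightarrow> c \<le> norm (\<phi> x)"
  shows "emeasure M S \<le> ennreal ((Lp_norm p M \<phi> / c) powr p)"
proof -
  have "ennreal (c powr p) * emeasure M S = (\<integral>\<^sup>+x. ennreal (c powr p) * indicator S x \<partial>M)"
    by (simp add: nn_integral_cmult_indicator)
  also have "\<dots> \<le> (\<integral>\<^sup>+x. ennreal (norm (\<phi> x) powr p) \<partial>M)"
    using p c bound by (intro nn_integral_mono) (auto simp: indicator_def powr_mono2)
  also have "\<dots> = ennreal (Lp_norm p M \<phi> powr p)"
    by (rule nn_integral_eq_Lp_norm_powr[OF p Lp])
  \<comment> \<open>The measure of \<open>S\<close> is not yet known to be finite, so the constant
    is cancelled inside \<open>ennreal\<close> by multiplying with its inverse.\<close>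
  finally have "ennreal (1 / c powr p) * (ennreal (c powr p) * emeasure M S)
    \<le> ennreal (1 / c powr p) * ennreal (Lp_norm p M \<phi> powr p)"
    by (rule mult_left_mono) simp
  moreover have "ennreal (1 / c powr p) * ennreal (c powr p) = 1"
    using c by (simp flip: ennreal_mult)
  moreover have "ennreal (1 / c powr p) * ennreal (Lp_norm p M \<phi> powr p)
    = ennreal ((Lp_norm p M \<phi> / c) powr p)"
    using c by (simp add: powr_divide Lp_norm_nonneg flip: ennreal_mult)
  ultimately show ?thesis
    by (simp add: mult.assoc[symmetric])
qed

text \<open>Errors in the transitivity argument have this shape: an approximation error, a piece cut
  off, and a piece transported by an iterate of \<open>f\<close> and rescaled.\<close>

lemma Lp_norm_triangle3:
  assumes p: "1 \<le> p" and "\<phi> \<in> Lp_functions p M" "\<psi> \<in> Lp_functions p M" "\<theta> \<in> Lp_functions p M"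
  shows "Lp_norm p M (\<lambda>x. (\<phi> x - \<psi> x) + r *\<^sub>R \<theta> x)
    \<le> Lp_norm p M \<phi> + Lp_norm p M \<psi> + \<bar>r\<bar> * Lp_norm p M \<theta>"
proof -
  have "Lp_norm p M (\<lambda>x. (\<phi> x - \<psi> x) + r *\<^sub>R \<theta> x)
      \<le> Lp_norm p M (\<lambda>x. \<phi> x - \<psi> x) + Lp_norm p M (\<lambda>x. r *\<^sub>R \<theta> x)"
    by (intro Lp_norm_triangle Lp_functions_diff Lp_functions_scaleR assms)
  then show ?thesis
    using Lp_norm_diff_triangle[OF assms(1-3)] Lp_norm_scaleR[OF p, of M r \<theta>] by simp
qed

lemma closure_of_Lp_iff:
  assumes p: "1 \<le> p" and "S \<subseteq> Lp p M"
  shows "Metric_space.mtopology (Lp p M) (Lp_dist p M) closure_of S = Lp p M \<longleftrightarrow>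
    (\<forall>a\<in>Lp p M. \<forall>\<delta>>0. \<exists>b\<in>S. Lp_dist p M a b < \<delta>)"
proof -
  interpret Metric_space "Lp p M" "Lp_dist p M" by (rule Metric_space_Lp[OF p])
  show ?thesis
    unfolding metric_closure_of using assms(2) by (auto simp: in_mball subset_iff)
qed

section \<open>Completeness\<close>

text \<open>A geometric series. The induction on \<open>k\<close>, for all \<open>n\<close> at once,
  peels off the first step; the constant 2 survives because 2 / 4 + 1 is at most 2.\<close>

lemma Lp_functions_Cauchy_telescope:
  assumes p: "1 \<le> p" and Lp: "\<And>n. \<phi> n \<in> Lp_functions p M"
    and step: "\<And>n. Lp_norm p M (\<lambda>x. \<phi> (Suc n) x - \<phi> n x) \<le> (1 / 4) ^ n"
  shows "Lp_norm p M (\<lambda>x. \<phi> (n + k) x - \<phi> n x) \<le> 2 * (1 / 4) ^ n"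
proof (induction k arbitrary: n)
  case 0
  have "Lp_norm p M (\<lambda>x. 0) = 0"
    using p by (simp add: Lp_norm_def)
  then show ?case by simp
next
  case (Suc k)
  have "Lp_norm p M (\<lambda>x. \<phi> (Suc n + k) x - \<phi> n x)
    \<le> Lp_norm p M (\<lambda>x. \<phi> (Suc n + k) x - \<phi> (Suc n) x) + Lp_norm p M (\<lambda>x. \<phi> (Suc n) x - \<phi> n x)"
    by (rule Lp_norm_triangle_through[OF p]) (rule Lp)+
  also have "\<dots> \<le> 2 * (1 / 4) ^ Suc n + (1 / 4) ^ n"
    by (intro add_mono Suc.IH step)
  also have "\<dots> \<le> 2 * (1 / 4) ^ n" by simp
  finally show ?case by simp
qed

text \<open>The increments are weighted by \<open>2 ^ n\<close>: the norms decay like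
  \<open>(1 / 4) ^ n\<close>, so the sum of the \<open>p\<close>-th powers of the weighted
  increments still has a finite integral. It is therefore finite almost everywhere, and there the
  increments are dominated by a multiple of \<open>(1 / 2) ^ n\<close>.\<close>

lemma AE_convergent_of_rapid_Cauchy:
  fixes \<phi> :: "nat \<Rightarrow> 'a \<Rightarrow> complex"
  assumes p: "1 \<le> p" and Lp: "\<And>n. \<phi> n \<in> Lp_functions p M"
    and step: "\<And>n. Lp_norm p M (\<lambda>x. \<phi> (Suc n) x - \<phi> n x) \<le> (1 / 4) ^ n"
  shows "AE x in M. convergent (\<lambda>n. \<phi> n x)"
proof -
  define d where "d n x = \<phi> (Suc n) x - \<phi> n x" for n x
  have dLp: "d n \<in> Lp_functions p M" for n
    unfolding d_def by (rule Lp_functions_diff[OF p]) (rule Lp)+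
  note [measurable] = Lp_functions_measurable[OF dLp]
  define h where "h n x = ennreal ((2 ^ n) powr p) * ennreal (norm (d n x) powr p)" for n x
  have h_int: "(\<integral>\<^sup>+x. h n x \<partial>M) \<le> ennreal ((1 / 2) ^ n)" for n
  proof -
    have "(\<integral>\<^sup>+x. h n x \<partial>M) = ennreal ((2 ^ n) powr p) * ennreal (Lp_norm p M (d n) powr p)"
      unfolding h_def by (simp add: nn_integral_cmult nn_integral_eq_Lp_norm_powr[OF p dLp])
    also have "\<dots> = ennreal ((2 ^ n * Lp_norm p M (d n)) powr p)"
      by (simp add: powr_mult Lp_norm_nonneg flip: ennreal_mult)
    also have "\<dots> \<le> ennreal (((1 / 2) ^ n) powr p)"
    proof -
      have "2 ^ n * Lp_norm p M (d n) \<le> 2 ^ n * (1 / 4) ^ n"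
        using step[of n] unfolding d_def by (intro mult_left_mono) auto
      also have "\<dots> = (1 / 2) ^ n"
        by (simp flip: power_mult_distrib)
      finally show ?thesis
        using p by (intro ennreal_leI powr_mono2) (auto simp: Lp_norm_nonneg)
    qed
    \<comment> \<open>A number in the unit interval does not grow when raised to a power
      \<open>p\<close> that is at least 1.\<close>
    also have "\<dots> \<le> ennreal ((1 / 2) ^ n)"
      using powr_mono'[of 1 p "(1 / 2 :: real) ^ n"] p
      by (intro ennreal_leI) (simp add: power_le_one)
    finally show ?thesis .
  qed
  have "(\<integral>\<^sup>+x. (\<Sum>n. h n x) \<partial>M) = (\<Sum>n. \<integral>\<^sup>+x. h n x \<partial>M)"
    by (rule nn_integral_suminf) (simp add: h_def)
  also have "\<dots> \<le> (\<Sum>n. ennreal ((1 / 2) ^ n))"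
    by (intro suminf_le h_int) auto
  also have "\<dots> < \<infinity>"
    by (simp add: suminf_ennreal2 summable_geometric)
  finally have "AE x in M. (\<Sum>n. h n x) \<noteq> \<infinity>"
    by (intro nn_integral_PInf_AE) (simp_all add: h_def)
  then show ?thesis
  proof eventually_elim
    case (elim x)
    then obtain K where K: "(\<Sum>n. h n x) = ennreal K" "0 \<le> K"
      by (cases "\<Sum>n. h n x") auto
    \<comment> \<open>A single term of the series is at most its finite sum \<open>K\<close>;
      solving for the increment gives a geometric majorant.\<close>
    have "norm (d n x) \<le> K powr (1 / p) * (1 / 2) ^ n" for n
    proof -
      have "ennreal ((2 ^ n * norm (d n x)) powr p) = h n x"
        by (simp add: h_def powr_mult ennreal_mult)
      also have "\<dots> \<le> ennreal K"
        using sum_le_suminf[of "\<lambda>n. h n x" "{n}"] K(1) by simp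
      finally have "(2 ^ n * norm (d n x)) powr p \<le> K"
        using K(2) by simp
      then have "((2 ^ n * norm (d n x)) powr p) powr (1 / p) \<le> K powr (1 / p)"
        using p by (intro powr_mono2) auto
      then have "2 ^ n * norm (d n x) \<le> K powr (1 / p)"
        using p by (simp add: powr_powr)
      then show ?thesis
        by (simp add: field_simps)
    qed
    then have "summable (\<lambda>n. d n x)"
      by (intro summable_comparison_test[of "\<lambda>n. d n x" "\<lambda>n. K powr (1 / p) * (1 / 2) ^ n"])
         (auto intro!: summable_mult summable_geometric)
    then have "convergent (\<lambda>n. \<Sum>i<n. d i x)"
      by (simp add: summable_iff_convergent)
    then have "convergent (\<lambda>n. (\<Sum>i<n. d i x) + \<phi> 0 x)"
      by (intro convergent_add convergent_const)
    moreover have "(\<Sum>i<n. d i x) + \<phi> 0 x = \<phi> n x" for n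
      using sum_lessThan_telescope[of "\<lambda>i. \<phi> i x" n] by (simp add: d_def)
    ultimately show ?case by simp
  qed
qed

lemma Lp_functions_rapid_Cauchy_limit:
  fixes \<phi> :: "nat \<Rightarrow> 'a \<Rightarrow> complex"
  assumes p: "1 \<le> p" and Lp: "\<And>n. \<phi> n \<in> Lp_functions p M"
    and step: "\<And>n. Lp_norm p M (\<lambda>x. \<phi> (Suc n) x - \<phi> n x) \<le> (1 / 4) ^ n"
  obtains \<psi> where "\<psi> \<in> Lp_functions p M" "(\<lambda>n. Lp_norm p M (\<lambda>x. \<phi> n x - \<psi> x)) \<longlonglongrightarrow> 0"
proof -
  note [measurable] = Lp_functions_measurable[OF Lp]
  \<comment> \<open>Where the sequence diverges \<open>lim\<close> is an unspecified value, but this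
    happens only on a null set, and \<open>\<psi>\<close> is measurable everywhere.\<close>
  define \<psi> where "\<psi> x = lim (\<lambda>n. \<phi> n x)" for x
  have [measurable]: "\<psi> \<in> borel_measurable M"
    unfolding \<psi>_def by measurable
  have bound: "(\<lambda>x. \<phi> n x - \<psi> x) \<in> Lp_functions p M \<and>
      Lp_norm p M (\<lambda>x. \<phi> n x - \<psi> x) \<le> 2 * (1 / 4) ^ n" for n
  proof -
    \<comment> \<open>Fatou's lemma is applied with \<open>n\<close> fixed and \<open>k\<close>
      tending to infinity, so that the telescoped bound passes to the limit.\<close>
    have "AE x in M. ennreal (norm (\<phi> n x - \<psi> x) powr p)
        = liminf (\<lambda>k. ennreal (norm (\<phi> (n + k) x - \<phi> n x) powr p))"
      using AE_convergent_of_rapid_Cauchy[OF assms]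
    proof eventually_elim
      case (elim x)
      then have "(\<lambda>k. \<phi> k x) \<longlonglongrightarrow> \<psi> x"
        by (simp add: \<psi>_def convergent_LIMSEQ_iff)
      then have "(\<lambda>k. \<phi> (n + k) x) \<longlonglongrightarrow> \<psi> x"
        using LIMSEQ_ignore_initial_segment[of "\<lambda>k. \<phi> k x" "\<psi> x" n] by (simp add: add.commute)
      then have "(\<lambda>k. ennreal (norm (\<phi> (n + k) x - \<phi> n x) powr p))
          \<longlonglongrightarrow> ennreal (norm (\<psi> x - \<phi> n x) powr p)"
        using p by (intro tendsto_ennrealI tendsto_powr' tendsto_norm tendsto_diff tendsto_const) auto
      then show ?case
        unfolding norm_minus_commute[of "\<phi> n x" "\<psi> x"]
        by (intro lim_imp_Liminf[symmetric]) simp_all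
    qed
    then have "(\<integral>\<^sup>+x. ennreal (norm (\<phi> n x - \<psi> x) powr p) \<partial>M)
        = (\<integral>\<^sup>+x. liminf (\<lambda>k. ennreal (norm (\<phi> (n + k) x - \<phi> n x) powr p)) \<partial>M)"
      by (rule nn_integral_cong_AE)
    also have "\<dots> \<le> liminf (\<lambda>k. \<integral>\<^sup>+x. ennreal (norm (\<phi> (n + k) x - \<phi> n x) powr p) \<partial>M)"
      by (rule nn_integral_liminf) simp
    also have "\<dots> \<le> limsup (\<lambda>k. \<integral>\<^sup>+x. ennreal (norm (\<phi> (n + k) x - \<phi> n x) powr p) \<partial>M)"
      by (simp add: Liminf_le_Limsup)
    also have "\<dots> \<le> ennreal ((2 * (1 / 4) ^ n) powr p)"
    proof (rule Limsup_bounded, rule always_eventually, rule allI)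
      fix k
      have "(\<integral>\<^sup>+x. ennreal (norm (\<phi> (n + k) x - \<phi> n x) powr p) \<partial>M)
          = ennreal (Lp_norm p M (\<lambda>x. \<phi> (n + k) x - \<phi> n x) powr p)"
        by (rule nn_integral_eq_Lp_norm_powr[OF p Lp_functions_diff[OF p Lp Lp]])
      also have "\<dots> \<le> ennreal ((2 * (1 / 4) ^ n) powr p)"
        using Lp_functions_Cauchy_telescope[OF assms] p
        by (intro ennreal_leI powr_mono2) (auto simp: Lp_norm_nonneg)
      finally show "(\<integral>\<^sup>+x. ennreal (norm (\<phi> (n + k) x - \<phi> n x) powr p) \<partial>M)
          \<le> ennreal ((2 * (1 / 4) ^ n) powr p)" .
    qed
    finally have *: "(\<integral>\<^sup>+x. ennreal (norm (\<phi> n x - \<psi> x) powr p) \<partial>M)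
        \<le> ennreal ((2 * (1 / 4) ^ n) powr p)" .
    show ?thesis
      using Lp_norm_le_of_nn_integral[OF p _ _ *] by simp
  qed
  \<comment> \<open>\<open>\<psi>\<close> is the difference of \<open>\<phi> 0\<close> and
    \<open>\<phi> 0 - \<psi>\<close>.\<close>
  have "\<psi> \<in> Lp_functions p M"
    using Lp_functions_diff[OF p Lp[of 0] conjunct1[OF bound[of 0]]] by simp
  moreover have "(\<lambda>n. 2 * (1 / 4 :: real) ^ n) \<longlonglongrightarrow> 2 * 0"
    by (intro tendsto_mult tendsto_const LIMSEQ_realpow_zero) auto
  then have "(\<lambda>n. Lp_norm p M (\<lambda>x. \<phi> n x - \<psi> x)) \<longlonglongrightarrow> 0"
    by (intro tendsto_sandwich[of "\<lambda>_. 0" "\<lambda>n. Lp_norm p M (\<lambda>x. \<phi> n x - \<psi> x)"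
          sequentially "\<lambda>n. 2 * (1 / 4) ^ n" 0])
       (use bound in \<open>auto simp: Lp_norm_nonneg\<close>)
  ultimately show ?thesis by (rule that)
qed

text \<open>A Cauchy sequence with a convergent subsequence converges, so it suffices to extract a
  subsequence whose representatives satisfy the rapid Cauchy condition.\<close>

lemma mcomplete_Lp:
  assumes p: "1 \<le> p"
  shows "Metric_space.mcomplete (Lp p M) (Lp_dist p M)"
proof -
  interpret Metric_space "Lp p M" "Lp_dist p M" by (rule Metric_space_Lp[OF p])
  show ?thesis
    unfolding mcomplete_def
  proof (intro allI impI)
    fix \<sigma> assume C: "MCauchy \<sigma>"
    then have in_Lp: "\<sigma> n \<in> Lp p M" for n by (auto simp: MCauchy_def)
    have "\<exists>N. \<forall>i\<ge>N. \<forall>j\<ge>N. Lp_dist p M (\<sigma> i) (\<sigma> j) < (1 / 4) ^ n" for n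
      using C unfolding MCauchy_def by (meson zero_less_power zero_less_divide_1_iff zero_less_numeral)
    then obtain N where N: "\<And>n i j. N n \<le> i \<Longrightarrow> N n \<le> j \<Longrightarrow> Lp_dist p M (\<sigma> i) (\<sigma> j) < (1 / 4) ^ n"
      by metis
    \<comment> \<open>The partial sum dominates \<open>N n\<close>, and the summand \<open>n\<close>
      makes \<open>r\<close> strictly increasing.\<close>
    define r where "r n = (\<Sum>i\<le>n. N i) + n" for n
    have r: "strict_mono r"
      by (rule strict_monoI_Suc) (simp add: r_def)
    have r_ge: "N n \<le> r n" for n
      using member_le_sum[of n "{..n}" N] by (simp add: r_def)
    define \<phi> where "\<phi> n = Lp_rep (\<sigma> (r n))" for n
    have \<phi>: "\<phi> n \<in> Lp_functions p M" "Lp_class p M (\<phi> n) = \<sigma> (r n)" for n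
      using Lp_rep[OF in_Lp] by (simp_all add: \<phi>_def)
    have "Lp_norm p M (\<lambda>x. \<phi> (Suc n) x - \<phi> n x) \<le> (1 / 4) ^ n" for n
    proof -
      have "r n \<le> r (Suc n)" using r by (simp add: strict_mono_less_eq)
      then show ?thesis
        using N[of n "r (Suc n)" "r n"] r_ge[of n] Lp_dist_class[OF p \<phi>(1) \<phi>(1), of "Suc n" n]
        by (simp add: \<phi>(2))
    qed
    from Lp_functions_rapid_Cauchy_limit[OF p \<phi>(1) this] obtain \<psi>
      where \<psi>: "\<psi> \<in> Lp_functions p M" "(\<lambda>n. Lp_norm p M (\<lambda>x. \<phi> n x - \<psi> x)) \<longlonglongrightarrow> 0"
      by blast
    have "Lp_dist p M (\<sigma> (r n)) (Lp_class p M \<psi>) = Lp_norm p M (\<lambda>x. \<phi> n x - \<psi> x)" for n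
      using Lp_dist_class[OF p \<phi>(1) \<psi>(1), of n] by (simp add: \<phi>(2))
    then have "limitin mtopology (\<sigma> \<circ> r) (Lp_class p M \<psi>) sequentially"
      unfolding limitin_metric_dist_null
      using \<psi> by (auto simp: Lp_class_in_Lp in_Lp)
    then show "\<exists>x. limitin mtopology \<sigma> x sequentially"
      using MCauchy_convergent_subsequence[OF C r] by blast
  qed
qed

section \<open>Simple functions in \<open>Lp_functions\<close>\<close>

text \<open>Dominated convergence: the approximating simple functions are bounded by
  \<open>2 * norm (\<phi> x)\<close>, so the errors are bounded by
  \<open>3 * norm (\<phi> x)\<close>.\<close>

lemma Lp_simple_function_dense:
  assumes p: "1 \<le> p" and Lp: "\<phi> \<in> Lp_functions p M" and "0 < \<delta>"
  obtains s where "simple_function M s" "s \<in> Lp_functions p M"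
    "Lp_norm p M (\<lambda>x. \<phi> x - s x) < \<delta>"
proof -
  note [measurable] = Lp_functions_measurable[OF Lp]
  from borel_measurable_implies_sequence_metric[OF Lp_functions_measurable[OF Lp], of 0]
  obtain s where s: "\<And>i. simple_function M (s i)"
    "\<And>x. x \<in> space M \<Longrightarrow> (\<lambda>i. s i x) \<longlonglongrightarrow> \<phi> x"
    "\<And>i x. x \<in> space M \<Longrightarrow> norm (s i x) \<le> 2 * norm (\<phi> x)"
    by (simp add: dist_norm) metis
  have [measurable]: "s i \<in> borel_measurable M" for i
    using s(1) by (rule borel_measurable_simple_function)
  let ?w = "\<lambda>x. 3 powr p * norm (\<phi> x) powr p"
  have w: "integrable M ?w"
    using Lp_functions_integrable[OF Lp] by simp
  have bound: "norm (norm (\<phi> x - s i x) powr p) \<le> ?w x" if "x \<in> space M" for i x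
  proof -
    have "norm (\<phi> x - s i x) \<le> 3 * norm (\<phi> x)"
      using norm_triangle_ineq4[of "\<phi> x" "s i x"] s(3)[OF that, of i] by simp
    then have "norm (\<phi> x - s i x) powr p \<le> (3 * norm (\<phi> x)) powr p"
      using p by (intro powr_mono2) auto
    then show ?thesis by (simp add: powr_mult)
  qed
  have lim: "(\<lambda>i. norm (\<phi> x - s i x) powr p) \<longlonglongrightarrow> 0" if "x \<in> space M" for x
  proof -
    have "(\<lambda>i. norm (\<phi> x - s i x) powr p) \<longlonglongrightarrow> norm (\<phi> x - \<phi> x) powr p"
      using p s(2)[OF that]
      by (intro tendsto_powr' tendsto_norm tendsto_diff tendsto_const) auto
    then show ?thesis by simp
  qed
  have int: "integrable M (\<lambda>x. norm (\<phi> x - s i x) powr p)" for i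
    by (rule Bochner_Integration.integrable_bound[OF w]) (use bound in \<open>auto intro!: AE_I2\<close>)
  have "(\<lambda>i. \<integral>x. norm (\<phi> x - s i x) powr p \<partial>M) \<longlonglongrightarrow> (\<integral>x. 0 \<partial>M)"
    by (rule integral_dominated_convergence[OF _ _ w]) (use bound lim in \<open>auto intro!: AE_I2\<close>)
  then have "(\<lambda>i. (\<integral>x. norm (\<phi> x - s i x) powr p \<partial>M) powr (1 / p)) \<longlonglongrightarrow> 0 powr (1 / p)"
    using p by (intro tendsto_powr' tendsto_const) auto
  then have "(\<lambda>i. Lp_norm p M (\<lambda>x. \<phi> x - s i x)) \<longlonglongrightarrow> 0"
    using p by (simp add: Lp_norm_def)
  then have "\<forall>\<^sub>F i in sequentially. Lp_norm p M (\<lambda>x. \<phi> x - s i x) < \<delta>"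
    using \<open>0 < \<delta>\<close> by (rule order_tendstoD(2))
  then obtain i where "Lp_norm p M (\<lambda>x. \<phi> x - s i x) < \<delta>"
    by (auto simp: eventually_sequentially)
  moreover have "(\<lambda>x. \<phi> x - s i x) \<in> Lp_functions p M"
    using int by (simp add: Lp_functions_def)
  then have "s i \<in> Lp_functions p M"
    using Lp_functions_diff[OF p Lp] by fastforce
  ultimately show ?thesis
    using that s(1) by blast
qed

text \<open>The finitely many nonzero values stay away from zero, so Markov's inequality applies to
  the whole support.\<close>

lemma simple_function_Lp_support:
  assumes p: "1 \<le> p" and s: "simple_function M s" and Lp: "s \<in> Lp_functions p M"
  shows "{x \<in> space M. s x \<noteq> 0} \<in> sets M" "emeasure M {x \<in> space M. s x \<noteq> 0} < \<infinity>"
proof -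
  note [measurable] = Lp_functions_measurable[OF Lp]
  show sets: "{x \<in> space M. s x \<noteq> 0} \<in> sets M" by measurable
  let ?R = "norm ` (s ` space M - {0})"
  have fin: "finite ?R" using simple_functionD(1)[OF s] by simp
  \<comment> \<open>Inserting 1 keeps the minimum meaningful when \<open>s\<close> vanishes
    identically.\<close>
  define c where "c = Min (insert 1 ?R)"
  have "0 < c" using fin by (auto simp: c_def)
  moreover have "c \<le> norm (s x)" if "x \<in> {x \<in> space M. s x \<noteq> 0}" for x
    unfolding c_def using fin that by (intro Min_le) auto
  ultimately have "emeasure M {x \<in> space M. s x \<noteq> 0} \<le> ennreal ((Lp_norm p M s / c) powr p)"
    by (rule Lp_Markov_inequality[OF p Lp sets])
  then show "emeasure M {x \<in> space M. s x \<noteq> 0} < \<infinity>"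
    by (rule le_less_trans) simp
qed

lemma simple_function_bounded:
  fixes s :: "'a \<Rightarrow> 'b :: real_normed_vector"
  assumes "simple_function M s"
  obtains C where "0 < C" "\<And>x. x \<in> space M \<Longrightarrow> norm (s x) \<le> C"
proof
  let ?R = "insert 1 (norm ` s ` space M)"
  have fin: "finite ?R" using simple_functionD(1)[OF assms] by simp
  show "0 < Max ?R" using fin by (simp add: Max_gr_iff)
  show "norm (s x) \<le> Max ?R" if "x \<in> space M" for x
    using fin that by (intro Max_ge) auto
qed

section \<open>Separability\<close>

text \<open>The closure is the union of an increasing sequence of countable stages, and two elements
  always meet in a common stage. It is used both for generating an algebra of sets and for closing a
  set of functions under addition; \<open>P\<close> records where the closure stays.\<close>

lemma countable_closure_under_binop:
  assumes "countable A" "A \<subseteq> P" and P: "\<And>x y. x \<in> P \<Longrightarrow> y \<in> P \<Longrightarrow> b x y \<in> P"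
  obtains D where "countable D" "A \<subseteq> D" "D \<subseteq> P" "\<And>x y. x \<in> D \<Longrightarrow> y \<in> D \<Longrightarrow> b x y \<in> D"
proof
  define E where "E = rec_nat A (\<lambda>_ X. X \<union> (\<lambda>(x, y). b x y) ` (X \<times> X))"
  have E0: "E 0 = A" and ES: "E (Suc n) = E n \<union> (\<lambda>(x, y). b x y) ` (E n \<times> E n)" for n
    by (simp_all add: E_def)
  have mono: "E m \<subseteq> E n" if "m \<le> n" for m n
    using that by (rule lift_Suc_mono_le[rotated]) (auto simp: ES)
  have "countable (E n)" for n
    by (induction n) (auto simp: E0 ES \<open>countable A\<close>)
  then show "countable (\<Union>n. E n)" by simp
  show "A \<subseteq> (\<Union>n. E n)" using E0 by auto
  have "E n \<subseteq> P" for n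
  proof (induction n)
    case (Suc n)
    then show ?case unfolding ES by (auto intro!: P)
  qed (simp add: E0 \<open>A \<subseteq> P\<close>)
  then show "(\<Union>n. E n) \<subseteq> P" by blast
  fix x y assume "x \<in> (\<Union>n. E n)" "y \<in> (\<Union>n. E n)"
  then obtain i j where "x \<in> E i" "y \<in> E j" by blast
  then have "x \<in> E (max i j)" "y \<in> E (max i j)"
    using mono[of i "max i j"] mono[of j "max i j"] by auto
  then have "b x y \<in> E (Suc (max i j))" by (auto simp: ES)
  then show "b x y \<in> (\<Union>n. E n)" by blast
qed

text \<open>Complements and unions are both generated by the single operation \<open>\<Omega> - (x \<inter> y)\<close>.\<close>

lemma countable_algebra_generated:
  assumes "countable \<A>" "\<A> \<subseteq> Pow \<Omega>"
  obtains \<G> where "countable \<G>" "algebra \<Omega> \<G>" "\<A> \<subseteq> \<G>" "\<G> \<subseteq> sigma_sets \<Omega> \<A>"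
proof -
  interpret S: sigma_algebra \<Omega> "sigma_sets \<Omega> \<A>"
    using assms(2) by (rule sigma_algebra_sigma_sets)
  obtain \<G> where \<G>: "countable \<G>" "insert {} \<A> \<subseteq> \<G>" "\<G> \<subseteq> sigma_sets \<Omega> \<A>"
    "\<And>x y. x \<in> \<G> \<Longrightarrow> y \<in> \<G> \<Longrightarrow> \<Omega> - (x \<inter> y) \<in> \<G>"
  proof (rule countable_closure_under_binop[of "insert {} \<A>" "sigma_sets \<Omega> \<A>" "\<lambda>x y. \<Omega> - (x \<inter> y)"])
    show "countable (insert {} \<A>)" using assms(1) by simp
    show "insert {} \<A> \<subseteq> sigma_sets \<Omega> \<A>" by (auto intro: sigma_sets.intros)
    show "\<Omega> - (x \<inter> y) \<in> sigma_sets \<Omega> \<A>"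
      if "x \<in> sigma_sets \<Omega> \<A>" "y \<in> sigma_sets \<Omega> \<A>" for x y
      using that by (intro S.compl_sets S.Int)
  qed (rule that)
  have sub: "x \<subseteq> \<Omega>" if "x \<in> \<G>" for x
    using that \<G>(3) S.sets_into_space by blast
  have compl: "\<Omega> - x \<in> \<G>" if "x \<in> \<G>" for x
    using \<G>(4)[OF that that] by simp
  have union: "x \<union> y \<in> \<G>" if "x \<in> \<G>" "y \<in> \<G>" for x y
  proof -
    have "x \<union> y = \<Omega> - ((\<Omega> - x) \<inter> (\<Omega> - y))" using sub that by blast
    then show ?thesis using \<G>(4)[OF compl compl] that by simp
  qed
  have "algebra \<Omega> \<G>"
    unfolding algebra_iff_Un using \<G>(2) sub compl union by auto
  then show ?thesis using that \<G> by blast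
qed

text \<open>The sets that can be approximated contain the algebra and are closed under complements
  and countable unions. Finiteness of the measure gives continuity from above in the union case. The
  premise on \<open>\<epsilon>\<close> stands in the conclusion because the induction varies
  \<open>\<epsilon>\<close>.\<close>

lemma (in finite_measure) approximation_by_algebra:
  assumes alg: "algebra (space M) \<G>" and gen: "sets M = sigma_sets (space M) \<G>"
    and A: "A \<in> sets M"
  shows "0 < \<epsilon> \<Longrightarrow> \<exists>G\<in>\<G>. measure M ((A - G) \<union> (G - A)) < \<epsilon>"
proof -
  interpret algebra "space M" \<G> by (rule alg)
  have \<G>_sets: "G \<in> sets M" if "G \<in> \<G>" for G
    using that by (simp add: gen sigma_sets.Basic)
  have "A \<in> sigma_sets (space M) \<G>" using A gen by simp
  then show "0 < \<epsilon> \<Longrightarrow> \<exists>G\<in>\<G>. measure M ((A - G) \<union> (G - A)) < \<epsilon>"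
  proof (induction arbitrary: \<epsilon> rule: sigma_sets.induct)
    case (Basic a)
    then show ?case by (intro bexI[of _ a]) auto
  next
    case Empty
    then show ?case by (intro bexI[of _ "{}"]) auto
  next
    case (Compl a)
    then obtain G where G: "G \<in> \<G>" "measure M ((a - G) \<union> (G - a)) < \<epsilon>" by blast
    have "a \<in> sets M" using Compl.hyps gen by simp
    then have "measure M ((space M - a - (space M - G)) \<union> (space M - G - (space M - a)))
        \<le> measure M ((a - G) \<union> (G - a))"
      using \<G>_sets[OF G(1)] by (intro finite_measure_mono) auto
    then show ?case using G by (intro bexI[of _ "space M - G"]) auto
  next
    case (Union a)
    have a[measurable]: "a i \<in> sets M" for i using Union.hyps gen by simp
    \<comment> \<open>Half of \<open>\<epsilon>\<close> pays for cutting the union off after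
      \<open>n\<close> sets; the other half is shared by the approximations of these sets.\<close>
    have "(\<lambda>n. measure M ((\<Union>i. a i) - (\<Union>i<n. a i))) \<longlonglongrightarrow> measure M (\<Inter>n. (\<Union>i. a i) - (\<Union>i<n. a i))"
      by (rule finite_Lim_measure_decseq) (auto simp: decseq_def)
    also have "(\<Inter>n. (\<Union>i. a i) - (\<Union>i<n. a i)) = {}" by auto
    finally have "(\<lambda>n. measure M ((\<Union>i. a i) - (\<Union>i<n. a i))) \<longlonglongrightarrow> 0" by simp
    then have "\<forall>\<^sub>F n in sequentially. measure M ((\<Union>i. a i) - (\<Union>i<n. a i)) < \<epsilon> / 2"
      using Union.prems by (intro order_tendstoD) auto
    then obtain n where n: "measure M ((\<Union>i. a i) - (\<Union>i<n. a i)) < \<epsilon> / 2"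
      by (auto simp: eventually_sequentially)
    \<comment> \<open>The denominator has \<open>real n + 1\<close> since \<open>n\<close> may be
      0.\<close>
    have "\<exists>G\<in>\<G>. measure M ((a i - G) \<union> (G - a i)) < \<epsilon> / (2 * (real n + 1))" for i
      using Union.prems by (intro Union.IH) simp
    then obtain G where G: "\<And>i. G i \<in> \<G>"
      "\<And>i. measure M ((a i - G i) \<union> (G i - a i)) < \<epsilon> / (2 * (real n + 1))" by metis
    note [measurable] = \<G>_sets[OF G(1)]
    let ?G = "\<Union>i<n. G i"
    have "measure M (((\<Union>i. a i) - ?G) \<union> (?G - (\<Union>i. a i)))
        \<le> measure M (((\<Union>i. a i) - (\<Union>i<n. a i)) \<union> (\<Union>i<n. (a i - G i) \<union> (G i - a i)))"
      by (intro finite_measure_mono) auto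
    also have "\<dots> \<le> measure M ((\<Union>i. a i) - (\<Union>i<n. a i)) + measure M (\<Union>i<n. (a i - G i) \<union> (G i - a i))"
      by (intro measure_Un_le) auto
    also have "measure M (\<Union>i<n. (a i - G i) \<union> (G i - a i))
        \<le> (\<Sum>i<n. measure M ((a i - G i) \<union> (G i - a i)))"
      by (intro finite_measure_subadditive_finite) auto
    also have "\<dots> \<le> (\<Sum>i<n. \<epsilon> / (2 * (real n + 1)))"
      by (intro sum_mono less_imp_le G(2))
    also have "\<dots> \<le> \<epsilon> / 2"
      using Union.prems by (simp add: field_simps)
    finally show ?case
      using n G(1) by (intro bexI[of _ ?G]) (auto intro!: finite_UN)
  qed
qed

lemma Lp_indicator_finite_measure:
  fixes c :: complex
  assumes p: "1 \<le> p" and A: "A \<in> sets M" and e: "emeasure M A \<le> ennreal e" "0 \<le> e"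
  shows "(\<lambda>x. c * indicator A x) \<in> Lp_functions p M"
    "Lp_norm p M (\<lambda>x. c * indicator A x) \<le> norm c * e powr (1 / p)"
  using Lp_norm_bounded_support[OF p _ A e, of "\<lambda>x. c * indicator A x" "norm c"] A
  by (auto simp: indicator_def)

text \<open>The dense set consists of finite sums of \<open>q * indicator (G \<inter> W n)\<close>
  with \<open>q\<close> in a countable dense subset of the complex plane, \<open>G\<close> in a
  countable generating algebra and \<open>W n\<close> in an exhaustion by sets of finite measure.
  Approximability is established successively for indicators inside some \<open>W n\<close>,
  indicators of sets of finite measure, simple functions, and everything.\<close>

lemma Lp_countable_dense:
  fixes M :: "'a measure"
  assumes p: "1 \<le> p" and "sigma_finite_measure M"
    and \<A>: "countable \<A>" "\<A> \<subseteq> Pow (space M)" "sets M = sigma_sets (space M) \<A>"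
  obtains D where "countable D" "D \<subseteq> Lp_functions p M"
    "\<And>\<phi> \<delta>. \<phi> \<in> Lp_functions p M \<Longrightarrow> 0 < \<delta> \<Longrightarrow> \<exists>g\<in>D. Lp_norm p M (\<lambda>x. \<phi> x - g x) < \<delta>"
proof -
  interpret sigma_finite_measure M by fact
  obtain W :: "nat \<Rightarrow> 'a set" where W: "range W \<subseteq> sets M" "(\<Union>n. W n) = space M"
    "\<And>n. emeasure M (W n) \<noteq> \<infinity>" "incseq W"
    using sigma_finite_incseq by blast
  have W_sets[measurable]: "W n \<in> sets M" for n using W(1) by auto
  obtain \<G> where \<G>: "countable \<G>" "algebra (space M) \<G>" "\<A> \<subseteq> \<G>" "\<G> \<subseteq> sets M"
    using countable_algebra_generated[OF \<A>(1,2)] \<A>(3) by metis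
  have gen: "sets M = sigma_sets (space M) \<G>"
  proof
    show "sets M \<subseteq> sigma_sets (space M) \<G>"
      using \<G>(3) \<A>(3) by (simp add: sigma_sets_mono')
    show "sigma_sets (space M) \<G> \<subseteq> sets M"
      using \<G>(4) by (rule sets.sigma_sets_subset)
  qed
  obtain Q :: "complex set" where Q: "countable Q" "\<And>X. open X \<Longrightarrow> X \<noteq> {} \<Longrightarrow> \<exists>d\<in>Q. d \<in> X"
    by (erule countable_dense_setE)
  \<comment> \<open>Sets of the algebra may have infinite measure; intersecting with
    \<open>W n\<close> keeps the function in \<open>Lp_functions\<close>.\<close>
  let ?I = "\<lambda>(q, G, n) x. q * indicator (G \<inter> W n) x :: complex"
  have I_Lp: "(\<lambda>x. c * indicator (A \<inter> W n) x) \<in> Lp_functions p M" if "A \<in> sets M" for c :: complex and A n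
  proof (rule Lp_indicator_finite_measure(1)[OF p])
    show "A \<inter> W n \<in> sets M" using that by simp
    show "emeasure M (A \<inter> W n) \<le> ennreal (measure M (W n))"
      using W(3)[of n] by (subst emeasure_eq_ennreal_measure[symmetric]) (auto intro!: emeasure_mono)
  qed simp
  have "countable (?I ` (Q \<times> \<G> \<times> UNIV))"
    using Q(1) \<G>(1) by auto
  moreover have "?I ` (Q \<times> \<G> \<times> UNIV) \<subseteq> Lp_functions p M"
    using \<G>(4) I_Lp by auto
  ultimately obtain D where D: "countable D" "?I ` (Q \<times> \<G> \<times> UNIV) \<subseteq> D" "D \<subseteq> Lp_functions p M"
    and D_add: "\<And>g h. g \<in> D \<Longrightarrow> h \<in> D \<Longrightarrow> (\<lambda>x. g x + h x) \<in> D"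
  proof (rule countable_closure_under_binop[where b = "\<lambda>g h x. g x + h x"])
    show "(\<lambda>x. g x + h x) \<in> Lp_functions p M"
      if "g \<in> Lp_functions p M" "h \<in> Lp_functions p M" for g h
      using that by (rule Lp_functions_add[OF p])
  qed (rule that)
  \<comment> \<open>The closure of \<open>D\<close>, described by the norm. It is closed under
    limits and sums, which drives all later stages.\<close>
  define approx where "approx \<phi> \<longleftrightarrow> \<phi> \<in> Lp_functions p M \<and>
      (\<forall>\<delta>>0. \<exists>g\<in>D. Lp_norm p M (\<lambda>x. \<phi> x - g x) < \<delta>)" for \<phi>
  have approx_limit: "approx \<phi>"
    if Lp: "\<phi> \<in> Lp_functions p M" and lim: "\<And>\<delta>. 0 < \<delta> \<Longrightarrow> \<exists>\<psi>. approx \<psi> \<and> Lp_norm p M (\<lambda>x. \<phi> x - \<psi> x) < \<delta>" for \<phi>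
    unfolding approx_def
  proof (intro conjI allI impI Lp)
    fix \<delta> :: real assume "0 < \<delta>"
    then obtain \<psi> where \<psi>: "approx \<psi>" "Lp_norm p M (\<lambda>x. \<phi> x - \<psi> x) < \<delta> / 2"
      using lim[of "\<delta> / 2"] by auto
    then obtain g where g: "g \<in> D" "Lp_norm p M (\<lambda>x. \<psi> x - g x) < \<delta> / 2"
      using \<open>0 < \<delta>\<close> unfolding approx_def by (metis half_gt_zero)
    have "Lp_norm p M (\<lambda>x. \<phi> x - g x) \<le> Lp_norm p M (\<lambda>x. \<phi> x - \<psi> x) + Lp_norm p M (\<lambda>x. \<psi> x - g x)"
      using \<psi>(1) g(1) D(3) by (intro Lp_norm_triangle_through[OF p Lp]) (auto simp: approx_def)
    then show "\<exists>g\<in>D. Lp_norm p M (\<lambda>x. \<phi> x - g x) < \<delta>"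
      using \<psi>(2) g by (intro bexI[of _ g]) auto
  qed
  have approx_add: "approx (\<lambda>x. \<phi> x + \<psi> x)" if "approx \<phi>" "approx \<psi>" for \<phi> \<psi>
    unfolding approx_def
  proof (intro conjI allI impI)
    have Lp: "\<phi> \<in> Lp_functions p M" "\<psi> \<in> Lp_functions p M" using that by (auto simp: approx_def)
    then show "(\<lambda>x. \<phi> x + \<psi> x) \<in> Lp_functions p M" by (rule Lp_functions_add[OF p])
    fix \<delta> :: real assume "0 < \<delta>"
    then have "0 < \<delta> / 2" by simp
    with that obtain g h where gh: "g \<in> D" "Lp_norm p M (\<lambda>x. \<phi> x - g x) < \<delta> / 2"
      "h \<in> D" "Lp_norm p M (\<lambda>x. \<psi> x - h x) < \<delta> / 2"
      unfolding approx_def by blast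
    have "Lp_norm p M (\<lambda>x. (\<phi> x - g x) + (\<psi> x - h x)) \<le> Lp_norm p M (\<lambda>x. \<phi> x - g x) + Lp_norm p M (\<lambda>x. \<psi> x - h x)"
      using Lp gh(1,3) D(3) by (intro Lp_norm_triangle[OF p] Lp_functions_diff[OF p]) auto
    then show "\<exists>k\<in>D. Lp_norm p M (\<lambda>x. \<phi> x + \<psi> x - k x) < \<delta>"
      using gh D_add[OF gh(1,3)] by (intro bexI[of _ "\<lambda>x. g x + h x"]) (auto simp: algebra_simps)
  qed
  have approx_indicator_W: "approx (\<lambda>x. c * indicator (A \<inter> W n) x)" if A[measurable]: "A \<in> sets M" for c A n
    unfolding approx_def
  proof (intro conjI allI impI I_Lp A)
    fix \<delta> :: real assume \<delta>: "0 < \<delta>"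
    define w where "w = measure M (W n)"
    have w: "emeasure M (W n) = ennreal w" "0 \<le> w"
      using W(3)[of n] by (simp_all add: w_def emeasure_eq_ennreal_measure)
    \<comment> \<open>Adding 1 avoids a division by zero for \<open>c = 0\<close>. The next choice
      makes the root of \<open>e\<close>, times \<open>a\<close>, equal to
      \<open>\<delta> / 4\<close>.\<close>
    define a where "a = norm c + 1"
    have a: "0 < a" "norm c \<le> a" by (simp_all add: a_def add_nonneg_pos)
    define e where "e = (\<delta> / (4 * a)) powr p"
    have "0 < e" using \<delta> a by (simp add: e_def)
    have e_root: "e powr (1 / p) = \<delta> / (4 * a)"
      unfolding e_def using \<delta> a p by (intro powr_powr_inverse) auto
    \<comment> \<open>The restriction of \<open>M\<close> to \<open>W n\<close> is finite, so
      approximation by the algebra is available for it.\<close>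
    let ?N = "density M (indicator (W n))"
    have N: "emeasure ?N B = emeasure M (B \<inter> W n)" if "B \<in> sets M" for B
      using that emeasure_restricted[of "W n" M B] by (simp add: Int_commute)
    interpret N: finite_measure ?N
    proof (rule finite_measureI)
      have "emeasure ?N (space M) = emeasure M (W n)"
        using N[of "space M"] sets.sets_into_space[OF W_sets[of n]] by (simp add: Int_absorb1)
      then show "emeasure ?N (space ?N) \<noteq> \<infinity>"
        using w(1) by simp
    qed
    have "\<exists>G\<in>\<G>. measure ?N ((A - G) \<union> (G - A)) < e"
    proof (rule N.approximation_by_algebra)
      show "algebra (space ?N) \<G>" using \<G>(2) by simp
      show "sets ?N = sigma_sets (space ?N) \<G>" using gen by simp
    qed (simp_all add: A \<open>0 < e\<close>)
    then obtain G where G: "G \<in> \<G>" "measure ?N ((A - G) \<union> (G - A)) < e" by blast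
    have G_sets[measurable]: "G \<in> sets M" using G(1) \<G>(4) by auto
    let ?\<Delta> = "((A - G) \<union> (G - A)) \<inter> W n"
    have "emeasure M ?\<Delta> = ennreal (measure ?N ((A - G) \<union> (G - A)))"
      by (subst N[symmetric]) (simp_all only: N.emeasure_eq_measure, measurable)
    also have "\<dots> \<le> ennreal e"
      using G(2) by (intro ennreal_leI) simp
    finally have \<Delta>: "emeasure M ?\<Delta> \<le> ennreal e" .
    define b where "b = w powr (1 / p) + 1"
    have b: "0 < b" "w powr (1 / p) \<le> b" by (simp_all add: b_def add_nonneg_pos)
    then have "0 < \<delta> / (2 * b)" using \<delta> by simp
    then obtain q where q: "q \<in> Q" "q \<in> ball c (\<delta> / (2 * b))"
      using Q(2)[of "ball c (\<delta> / (2 * b))"] by auto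
    \<comment> \<open>\<open>?u\<close> is the error of replacing \<open>A\<close> by
      \<open>G\<close>, supported in the symmetric difference; \<open>?v\<close> is the error of
      replacing \<open>c\<close> by \<open>q\<close>.\<close>
    let ?u = "\<lambda>x. c * indicator (A \<inter> W n) x - c * indicator (G \<inter> W n) x"
    let ?v = "\<lambda>x. (c - q) * indicator (G \<inter> W n) x"
    have "Lp_norm p M ?u \<le> norm c * e powr (1 / p)"
      by (rule Lp_norm_bounded_support(2)[OF p _ _ \<Delta>])
        (use \<open>0 < e\<close> in \<open>auto simp: indicator_def\<close>)
    also have "\<dots> \<le> a * (\<delta> / (4 * a))"
      unfolding e_root using \<delta> a by (intro mult_right_mono) auto
    also have "\<dots> = \<delta> / 4"
      using a by simp
    finally have u: "Lp_norm p M ?u \<le> \<delta> / 4" .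
    have "emeasure M (G \<inter> W n) \<le> ennreal w"
      unfolding w(1)[symmetric] by (intro emeasure_mono) auto
    then have "Lp_norm p M ?v \<le> norm (c - q) * w powr (1 / p)"
      using w(2) by (intro Lp_indicator_finite_measure(2)[OF p]) auto
    also have "\<dots> \<le> \<delta> / (2 * b) * b"
      using q(2) b \<delta> by (intro mult_mono) (auto simp: dist_norm)
    also have "\<dots> = \<delta> / 2"
      using b by simp
    finally have v: "Lp_norm p M ?v \<le> \<delta> / 2" .
    have "Lp_norm p M (\<lambda>x. ?u x + ?v x) \<le> Lp_norm p M ?u + Lp_norm p M ?v"
      by (rule Lp_norm_triangle[OF p Lp_functions_diff[OF p I_Lp[OF A] I_Lp[OF G_sets]] I_Lp[OF G_sets]])
    also have "(\<lambda>x. ?u x + ?v x) = (\<lambda>x. c * indicator (A \<inter> W n) x - q * indicator (G \<inter> W n) x)"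
      by (simp add: left_diff_distrib)
    also have "Lp_norm p M ?u + Lp_norm p M ?v < \<delta>"
      using u v \<delta> by simp
    finally have "Lp_norm p M (\<lambda>x. c * indicator (A \<inter> W n) x - q * indicator (G \<inter> W n) x) < \<delta>" .
    moreover have "(\<lambda>x. q * indicator (G \<inter> W n) x) \<in> D"
      using subsetD[OF D(2) imageI[of "(q, G, n)"]] q(1) G(1) by simp
    ultimately show "\<exists>g\<in>D. Lp_norm p M (\<lambda>x. c * indicator (A \<inter> W n) x - g x) < \<delta>"
      by (rule bexI[where x = "\<lambda>x. q * indicator (G \<inter> W n) x"])
  qed
  have approx_indicator: "approx (\<lambda>x. c * indicator A x)"
    if A[measurable]: "A \<in> sets M" and fin: "emeasure M A < \<infinity>" for c A
  proof (rule approx_limit)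
    show "(\<lambda>x. c * indicator A x) \<in> Lp_functions p M"
      by (rule Lp_indicator_finite_measure(1)[OF p A, of "measure M A"])
        (use fin in \<open>auto simp: emeasure_eq_ennreal_measure\<close>)
    fix \<delta> :: real assume \<delta>: "0 < \<delta>"
    define a where "a = norm c + 1"
    have a: "0 < a" "norm c \<le> a" by (simp_all add: a_def add_nonneg_pos)
    define e where "e = (\<delta> / (2 * a)) powr p"
    have "0 < e" using \<delta> a by (simp add: e_def)
    have e_root: "e powr (1 / p) = \<delta> / (2 * a)"
      unfolding e_def using \<delta> a p by (intro powr_powr_inverse) auto
    \<comment> \<open>As \<open>A\<close> has finite measure, continuity from above makes the part
      of \<open>A\<close> outside \<open>W n\<close> negligible.\<close>
    have "(\<lambda>n. emeasure M (A - W n)) \<longlonglongrightarrow> emeasure M (\<Inter>n. A - W n)"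
    proof (rule Lim_emeasure_decseq)
      show "decseq (\<lambda>n. A - W n)"
        using W(4) by (auto simp: decseq_def incseq_def)
      show "emeasure M (A - W n) \<noteq> \<infinity>" for n
        using emeasure_mono[of "A - W n" A M] fin by (auto simp: top_unique)
    qed auto
    also have "(\<Inter>n. A - W n) = {}"
      using W(2) sets.sets_into_space[OF A] by auto
    finally have "(\<lambda>n. emeasure M (A - W n)) \<longlonglongrightarrow> 0" by simp
    then have "\<forall>\<^sub>F n in sequentially. emeasure M (A - W n) < ennreal e"
      using \<open>0 < e\<close> by (intro order_tendstoD) auto
    then obtain n where n: "emeasure M (A - W n) < ennreal e"
      by (auto simp: eventually_sequentially)
    have "Lp_norm p M (\<lambda>x. c * indicator (A - W n) x) \<le> norm c * e powr (1 / p)"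
      using n \<open>0 < e\<close> by (intro Lp_indicator_finite_measure(2)[OF p]) auto
    also have "\<dots> \<le> a * (\<delta> / (2 * a))"
      unfolding e_root using \<delta> a by (intro mult_right_mono) auto
    also have "\<dots> < \<delta>"
      using \<delta> a by simp
    also have "(\<lambda>x. c * indicator (A - W n) x) = (\<lambda>x. c * indicator A x - c * indicator (A \<inter> W n) x)"
      by (auto simp: indicator_def)
    finally show "\<exists>\<psi>. approx \<psi> \<and> Lp_norm p M (\<lambda>x. c * indicator A x - \<psi> x) < \<delta>"
      using approx_indicator_W[OF A, of c n] by blast
  qed
  have approx_sum: "approx (\<lambda>x. \<Sum>i\<in>I. h i x)" if "finite I" "\<And>i. i \<in> I \<Longrightarrow> approx (h i)"
    for I :: "complex set" and h
    using that
  proof (induction I)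
    case empty
    then show ?case using approx_indicator[of "{}" 0] by simp
  next
    case (insert i I)
    then show ?case using approx_add[of "h i" "\<lambda>x. \<Sum>i\<in>I. h i x"] by simp
  qed
  have approx_simple: "approx s" if s: "simple_function M s" and Lp: "s \<in> Lp_functions p M" for s
  proof (rule approx_limit[OF Lp])
    fix \<delta> :: real assume "0 < \<delta>"
    let ?s = "\<lambda>x. \<Sum>y\<in>s ` space M. y * indicator (s -` {y} \<inter> space M) x"
    have "approx (\<lambda>x. y * indicator (s -` {y} \<inter> space M) x)" if "y \<in> s ` space M" for y
    proof (cases "y = 0")
      case True
      then show ?thesis using approx_indicator[of "{}" 0] by simp
    next
      case False
      have "emeasure M (s -` {y} \<inter> space M) \<le> emeasure M {x \<in> space M. s x \<noteq> 0}"
        using simple_function_Lp_support(1)[OF p s Lp] False by (intro emeasure_mono) auto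
      also have "\<dots> < \<infinity>" by (rule simple_function_Lp_support(2)[OF p s Lp])
      finally show ?thesis
        using simple_functionD(2)[OF s] by (intro approx_indicator)
    qed
    then have approx: "approx ?s"
      using simple_functionD(1)[OF s] by (intro approx_sum) auto
    \<comment> \<open>Only the summand with \<open>y = s x\<close> survives.\<close>
    have "s x - ?s x = 0" if "x \<in> space M" for x
    proof -
      have "?s x = (\<Sum>y\<in>{s x}. y * indicator (s -` {y} \<inter> space M) x)"
        using simple_functionD(1)[OF s] that
        by (intro sum.mono_neutral_right) (auto simp: indicator_def)
      then show ?thesis using that by simp
    qed
    then have "AE x in M. s x - ?s x = 0" by (intro AE_I2)
    moreover have "?s \<in> Lp_functions p M" using approx by (simp add: approx_def)
    ultimately have "Lp_norm p M (\<lambda>x. s x - ?s x) = 0"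
      using Lp_norm_eq_0_iff[OF p Lp_functions_diff[OF p Lp]] by blast
    then show "\<exists>\<psi>. approx \<psi> \<and> Lp_norm p M (\<lambda>x. s x - \<psi> x) < \<delta>"
      using approx \<open>0 < \<delta>\<close> by (intro exI[of _ ?s]) simp
  qed
  have "approx \<phi>" if "\<phi> \<in> Lp_functions p M" for \<phi>
    using that
  proof (rule approx_limit)
    fix \<delta> :: real assume "0 < \<delta>"
    with that obtain s where "simple_function M s" "s \<in> Lp_functions p M"
      "Lp_norm p M (\<lambda>x. \<phi> x - s x) < \<delta>"
      by (rule Lp_simple_function_dense[OF p])
    then show "\<exists>\<psi>. approx \<psi> \<and> Lp_norm p M (\<lambda>x. \<phi> x - \<psi> x) < \<delta>"
      using approx_simple by blast
  qed
  then show ?thesis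
    using that[OF D(1,3)] by (simp add: approx_def)
qed

section \<open>Iterates of the composition operator\<close>

context composition_dynamical_system
begin

lemma space_M: "space M = UNIV"
  using sets_eq_imp_space_eq[OF sets_M] by simp

text \<open>Each point has a neighbourhood of finite measure, which contains a basic open set around
  the point; so the countably many basic sets of finite measure cover the space.\<close>

lemma sigma_finite: "sigma_finite_measure M"
proof
  obtain \<B> :: "'a set set" where \<B>: "countable \<B>" "topological_basis \<B>"
    using ex_countable_basis by blast
  let ?A = "{b \<in> \<B>. emeasure M b \<noteq> \<infinity>}"
  have "countable ?A" using \<B>(1) by simp
  moreover have "?A \<subseteq> sets M"
    using topological_basis_open[OF \<B>(2)] by (auto simp: sets_M)
  moreover have "\<exists>b\<in>?A. x \<in> b" for x
  proof -
    obtain U where U: "open U" "x \<in> U" "emeasure M U < \<infinity>"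
      using locally_finite by blast
    from topological_basisE[OF \<B>(2) U(1,2)] obtain b where b: "b \<in> \<B>" "x \<in> b" "b \<subseteq> U" .
    have "emeasure M b \<le> emeasure M U"
      using b U by (intro emeasure_mono) (auto simp: sets_M)
    then show ?thesis using b U(3) by (intro bexI[of _ b]) auto
  qed
  then have "\<Union> ?A = space M" unfolding space_M by blast
  ultimately show "\<exists>A. countable A \<and> A \<subseteq> sets M \<and> \<Union> A = space M \<and> (\<forall>a\<in>A. emeasure M a \<noteq> \<infinity>)"
    by blast
qed

lemma Lp_separable:
  assumes "1 \<le> p"
  obtains D where "countable D" "D \<subseteq> Lp_functions p M"
    "\<And>\<phi> \<delta>. \<phi> \<in> Lp_functions p M \<Longrightarrow> 0 < \<delta> \<Longrightarrow> \<exists>g\<in>D. Lp_norm p M (\<lambda>x. \<phi> x - g x) < \<delta>"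
proof -
  obtain \<B> :: "'a set set" where \<B>: "countable \<B>" "topological_basis \<B>"
    using ex_countable_basis by blast
  have "sets M = sigma_sets (space M) \<B>"
    unfolding sets_M space_M borel_eq_countable_basis[OF \<B>] by (simp add: sets_measure_of)
  then show ?thesis
    using Lp_countable_dense[OF assms sigma_finite \<B>(1)] that by (auto simp: space_M)
qed

lemma measurable_funpow [measurable]: "f ^^ n \<in> measurable M M"
  by (rule measurable_compose_n[OF measurable_f])

lemma vimage_funpow_sets: "A \<in> sets M \<Longrightarrow> (f ^^ n) -` A \<in> sets M"
  using measurable_sets[OF measurable_funpow, of A n] by (simp add: space_M)

lemma bij_funpow: "bij (f ^^ n)"
  by (rule bij_fn[OF bij_f])

lemma measurable_inv_funpow [measurable]: "inv (f ^^ n) \<in> measurable M M"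
  unfolding inv_fn[OF bij_f] by (rule measurable_compose_n[OF measurable_inv_f])

text \<open>The image is the preimage under the inverse iterate, which is measurable.\<close>

lemma image_funpow_sets: "A \<in> sets M \<Longrightarrow> (f ^^ n) ` A \<in> sets M"
  using measurable_sets[OF measurable_inv_funpow, of A n]
    bij_vimage_eq_inv_image[OF bij_imp_bij_inv[OF bij_funpow], of n A]
  by (simp add: space_M inv_inv_eq[OF bij_funpow])

lemma Lp_functions_comp_funpow:
  assumes "\<phi> \<in> Lp_functions p M"
  shows "(\<lambda>x. \<phi> ((f ^^ n) x)) \<in> Lp_functions p M"
proof (induction n)
  case (Suc n)
  then show ?case
    using Lp_functions_comp[of "\<lambda>x. \<phi> ((f ^^ n) x)"] by (simp add: o_def funpow_swap1)
qed (simp add: assms)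

lemma Lp_comp_funpow_class:
  assumes "\<phi> \<in> Lp_functions p M"
  shows "(Lp_comp p M f ^^ n) (Lp_class p M \<phi>) = Lp_class p M (\<lambda>x. \<phi> ((f ^^ n) x))"
proof (induction n)
  case (Suc n)
  then show ?case
    using Lp_comp_class[OF Lp_functions_comp_funpow[OF assms, of n]]
    by (simp add: o_def funpow_swap1[of f])
qed simp

lemma Lp_scaleR_comp_funpow_class:
  assumes "\<phi> \<in> Lp_functions p M"
  shows "Lp_scaleR p M r ((Lp_comp p M f ^^ n) (Lp_class p M \<phi>))
    = Lp_class p M (\<lambda>x. r *\<^sub>R \<phi> ((f ^^ n) x))"
  using Lp_scaleR_class[OF Lp_functions_comp_funpow[OF assms]] Lp_comp_funpow_class[OF assms]
  by simp

text \<open>The image of \<open>M\<close> under \<open>f\<close> is at most \<open>C\<close> times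
  \<open>M\<close>, so the operator norm is at most \<open>C powr (1 / p)\<close>.\<close>

lemma Lp_norm_comp_bounded:
  assumes p: "1 \<le> p"
  shows "\<exists>C\<ge>0. \<forall>\<phi>\<in>Lp_functions p M. Lp_norm p M (\<lambda>x. \<phi> (f x)) \<le> C * Lp_norm p M \<phi>"
proof -
  obtain C where C: "C > 0" "\<forall>A\<in>sets M. emeasure M (f -` A) \<le> ennreal C * emeasure M A"
    using distr_f_le by blast
  note [measurable] = measurable_f
  have "Lp_norm p M (\<lambda>x. \<phi> (f x)) \<le> C powr (1 / p) * Lp_norm p M \<phi>" if Lp: "\<phi> \<in> Lp_functions p M" for \<phi>
  proof -
    note [measurable] = Lp_functions_measurable[OF Lp]
    have "(\<integral>\<^sup>+x. ennreal (norm (\<phi> (f x)) powr p) \<partial>M) = (\<integral>\<^sup>+x. ennreal (norm (\<phi> x) powr p) \<partial>distr M M f)"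
      by (simp add: nn_integral_distr)
    also have "... \<le> (\<integral>\<^sup>+x. ennreal (norm (\<phi> x) powr p) \<partial>density M (\<lambda>_. ennreal C))"
      by (rule nn_integral_mono_measure)
         (use C in \<open>auto simp: le_measure emeasure_distr emeasure_density_const space_M\<close>)
    also have "... = ennreal C * ennreal (Lp_norm p M \<phi> powr p)"
      by (simp add: nn_integral_density nn_integral_cmult nn_integral_eq_Lp_norm_powr[OF p Lp])
    also have "\<dots> = ennreal ((C powr (1 / p) * Lp_norm p M \<phi>) powr p)"
      using C(1) p by (simp add: powr_mult powr_powr ennreal_mult Lp_norm_nonneg)
    finally show ?thesis
      by (intro Lp_norm_le_of_nn_integral(2)[OF p]) (auto simp: Lp_norm_nonneg)
  qed
  then show ?thesis by (intro exI[of _ "C powr (1 / p)"]) auto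
qed

lemma Lp_norm_comp_funpow_bounded:
  assumes p: "1 \<le> p"
  shows "\<exists>C\<ge>0. \<forall>\<phi>\<in>Lp_functions p M. Lp_norm p M (\<lambda>x. \<phi> ((f ^^ n) x)) \<le> C * Lp_norm p M \<phi>"
proof -
  obtain C where C: "0 \<le> C" "\<And>\<phi>. \<phi> \<in> Lp_functions p M \<Longrightarrow> Lp_norm p M (\<lambda>x. \<phi> (f x)) \<le> C * Lp_norm p M \<phi>"
    using Lp_norm_comp_bounded[OF p] by blast
  have "Lp_norm p M (\<lambda>x. \<phi> ((f ^^ n) x)) \<le> C ^ n * Lp_norm p M \<phi>" if Lp: "\<phi> \<in> Lp_functions p M" for \<phi>
  proof (induction n)
    case (Suc n)
    have "Lp_norm p M (\<lambda>x. \<phi> ((f ^^ n) (f x))) \<le> C * Lp_norm p M (\<lambda>x. \<phi> ((f ^^ n) x))"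
      by (rule C(2)[OF Lp_functions_comp_funpow[OF Lp]])
    also have "\<dots> \<le> C * (C ^ n * Lp_norm p M \<phi>)"
      by (rule mult_left_mono[OF Suc.IH C(1)])
    finally show ?case by (simp add: funpow_swap1 mult.assoc)
  qed simp
  then show ?thesis using C(1) by (intro exI[of _ "C ^ n"]) auto
qed

text \<open>Continuity of the multiples of iterates on classes; it makes the sets in the Baire
  argument open.\<close>

lemma Lp_dist_scaleR_comp_le:
  assumes p: "1 \<le> p"
  shows "\<exists>C\<ge>0. \<forall>a\<in>Lp p M. \<forall>b\<in>Lp p M.
    Lp_dist p M (Lp_scaleR p M r ((Lp_comp p M f ^^ n) a)) (Lp_scaleR p M r ((Lp_comp p M f ^^ n) b))
      \<le> C * Lp_dist p M a b"
proof -
  obtain C where C: "0 \<le> C"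
    "\<And>\<phi>. \<phi> \<in> Lp_functions p M \<Longrightarrow> Lp_norm p M (\<lambda>x. \<phi> ((f ^^ n) x)) \<le> C * Lp_norm p M \<phi>"
    using Lp_norm_comp_funpow_bounded[OF p] by blast
  have "Lp_dist p M (Lp_scaleR p M r ((Lp_comp p M f ^^ n) a)) (Lp_scaleR p M r ((Lp_comp p M f ^^ n) b))
      \<le> \<bar>r\<bar> * C * Lp_dist p M a b" if "a \<in> Lp p M" "b \<in> Lp p M" for a b
  proof -
    define \<phi> \<psi> where "\<phi> = Lp_rep a" and "\<psi> = Lp_rep b"
    have Lp: "\<phi> \<in> Lp_functions p M" "\<psi> \<in> Lp_functions p M"
      and ab: "a = Lp_class p M \<phi>" "b = Lp_class p M \<psi>"
      using Lp_rep[OF that(1)] Lp_rep[OF that(2)] by (simp_all add: \<phi>_def \<psi>_def)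
    have "Lp_dist p M (Lp_scaleR p M r ((Lp_comp p M f ^^ n) a)) (Lp_scaleR p M r ((Lp_comp p M f ^^ n) b))
      = Lp_norm p M (\<lambda>x. r *\<^sub>R \<phi> ((f ^^ n) x) - r *\<^sub>R \<psi> ((f ^^ n) x))"
      unfolding ab Lp_scaleR_comp_funpow_class[OF Lp(1)] Lp_scaleR_comp_funpow_class[OF Lp(2)]
      by (rule Lp_dist_class[OF p]) (intro Lp_functions_scaleR Lp_functions_comp_funpow Lp)+
    also have "\<dots> = \<bar>r\<bar> * Lp_norm p M (\<lambda>x. \<phi> ((f ^^ n) x) - \<psi> ((f ^^ n) x))"
      by (simp add: Lp_norm_scaleR[OF p, symmetric] scaleR_diff_right)
    also have "\<dots> \<le> \<bar>r\<bar> * (C * Lp_norm p M (\<lambda>x. \<phi> x - \<psi> x))"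
      using C(2)[OF Lp_functions_diff[OF p Lp]] by (intro mult_left_mono) auto
    also have "Lp_norm p M (\<lambda>x. \<phi> x - \<psi> x) = Lp_dist p M a b"
      unfolding ab by (rule Lp_dist_class[OF p Lp, symmetric])
    finally show ?thesis by (simp add: mult.assoc)
  qed
  then show ?thesis using C(1) by (intro exI[of _ "\<bar>r\<bar> * C"]) auto
qed

section \<open>Supercyclicity\<close>

lemma orbit_in_Lp:
  assumes "a \<in> Lp p M"
  shows "Lp_scaleR p M r ((Lp_comp p M f ^^ n) a) \<in> Lp p M"
  using Lp_scaleR_comp_funpow_class[OF Lp_rep(1)[OF assms], of r n] Lp_rep[OF assms]
  by (simp add: Lp_class_in_Lp Lp_functions_scaleR Lp_functions_comp_funpow)

section \<open>From supercyclicity to small images\<close>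

text \<open>Since \<open>r\<close> is real, where \<open>r \<phi> \<circ> f\<^sup>k\<close> is close to the imaginary number \<open>c\<close> the function
  \<open>\<phi> \<circ> f\<^sup>k\<close> is far from both values of the indicator function of \<open>B\<close>.\<close>

lemma approximation_imp_small_images:
  fixes c :: complex
  assumes p: "1 \<le> p" and Lp: "\<phi> \<in> Lp_functions p M"
    and B[measurable]: "B \<in> sets M" and fin: "emeasure M B < \<infinity>"
    and c: "Re c = 0" "\<bar>Im c\<bar> = 1" and r: "r \<noteq> 0"
    and u: "Lp_norm p M (\<lambda>x. \<phi> x - indicator B x) < \<delta>"
    and v: "Lp_norm p M (\<lambda>x. r *\<^sub>R \<phi> ((f ^^ k) x) - c * indicator B x) < \<delta>"
  obtains B' where "B' \<in> sets M" "B' \<subseteq> B"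
    "emeasure M (B - B') < ennreal (2 * (2 * \<delta>) powr p)"
    "emeasure M ((f ^^ k) ` B') < ennreal (\<bar>r\<bar> powr p * (2 * \<delta>) powr p)"
    "emeasure M ((f ^^ k) -` B') < ennreal (\<bar>r\<bar> powr (- p) * (2 * \<delta>) powr p)"
proof -
  define F where "F = f ^^ k"
  have [measurable]: "F \<in> measurable M M" unfolding F_def by (rule measurable_funpow)
  note [measurable] = Lp_functions_measurable[OF Lp]
  have ind: "(\<lambda>x. a * indicator B x) \<in> Lp_functions p M" for a :: complex
    using fin by (intro Lp_indicator_finite_measure(1)[OF p B, of "measure M B"])
      (auto simp: emeasure_eq_ennreal_measure)
  define U where "U x = \<phi> x - indicator B x" for x
  define V where "V x = r *\<^sub>R \<phi> (F x) - c * indicator B x" for x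
  have U: "U \<in> Lp_functions p M" "Lp_norm p M U < \<delta>"
    using Lp_functions_diff[OF p Lp ind[of 1]] u by (simp_all add: U_def[abs_def])
  have V: "V \<in> Lp_functions p M" "Lp_norm p M V < \<delta>"
    using Lp_functions_diff[OF p Lp_functions_scaleR[OF Lp_functions_comp_funpow[OF Lp]] ind[of c]] v
    by (simp_all add: V_def[abs_def] F_def)
  have \<delta>: "0 < \<delta>" using U(2) Lp_norm_nonneg[of p M U] by linarith
  have Markov: "emeasure M S < ennreal ((\<delta> / a) powr p)"
    if "W \<in> Lp_functions p M" "Lp_norm p M W < \<delta>" "S \<in> sets M" "0 < a" "\<And>x. x \<in> S \<Longrightarrow> a \<le> norm (W x)"
    for W S a
  proof -
    have "emeasure M S \<le> ennreal ((Lp_norm p M W / a) powr p)"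
      by (rule Lp_Markov_inequality[OF p that(1,3,4,5)])
    also have "\<dots> < ennreal ((\<delta> / a) powr p)"
      using that(2,4) p \<delta>
      by (intro ennreal_lessI powr_less_mono2 divide_strict_right_mono divide_nonneg_pos Lp_norm_nonneg) auto
    finally show ?thesis .
  qed
  define B' where "B' = {x \<in> B. norm (U x) \<le> 1 / 2 \<and> norm (V x) \<le> 1 / 2}"
  note [measurable] = Lp_functions_measurable[OF U(1)] Lp_functions_measurable[OF V(1)]
  have B'_space: "B' = {x \<in> space M. x \<in> B \<and> norm (U x) \<le> 1 / 2 \<and> norm (V x) \<le> 1 / 2}"
    by (simp add: B'_def space_M)
  have B'[measurable]: "B' \<in> sets M" unfolding B'_space by measurable
  \<comment> \<open>Closeness to \<open>c\<close> forces a large imaginary part of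
    \<open>r *\<^sub>R \<phi> (F x)\<close>. The indicator is real, so subtracting it inside
    \<open>U\<close> leaves the imaginary part unchanged.\<close>
  have far_U: "1 / (2 * \<bar>r\<bar>) \<le> norm (U (F x))" if "x \<in> B'" for x
  proof -
    have "norm (V x) \<le> 1 / 2" "x \<in> B" using that by (auto simp: B'_def)
    then have "norm (r *\<^sub>R \<phi> (F x) - c) \<le> 1 / 2" by (simp add: V_def)
    then have "\<bar>Im (r *\<^sub>R \<phi> (F x) - c)\<bar> \<le> 1 / 2" using abs_Im_le_cmod order_trans by blast
    then have "1 / 2 \<le> \<bar>Im (r *\<^sub>R \<phi> (F x))\<bar>" using c(2) unfolding minus_complex.sel by linarith
    also have "Im (r *\<^sub>R \<phi> (F x)) = Im (r *\<^sub>R U (F x))"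
      by (simp add: U_def indicator_def)
    also have "\<bar>\<dots>\<bar> \<le> \<bar>r\<bar> * norm (U (F x))"
      using abs_Im_le_cmod[of "r *\<^sub>R U (F x)"] by simp
    finally show ?thesis using r by (simp add: field_simps)
  qed
  \<comment> \<open>The mirror image: \<open>\<phi> (F y)\<close> has a large real part, and
    subtracting a multiple of the imaginary \<open>c\<close> does not affect it.\<close>
  have far_V: "\<bar>r\<bar> / 2 \<le> norm (V y)" if "F y \<in> B'" for y
  proof -
    have "norm (U (F y)) \<le> 1 / 2" "F y \<in> B" using that by (auto simp: B'_def)
    then have "norm (\<phi> (F y) - 1) \<le> 1 / 2" by (simp add: U_def)
    then have "\<bar>Re (\<phi> (F y) - 1)\<bar> \<le> 1 / 2" using abs_Re_le_cmod order_trans by blast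
    then have "1 / 2 \<le> \<bar>Re (\<phi> (F y))\<bar>"
      unfolding minus_complex.sel one_complex.sel by linarith
    then have "\<bar>r\<bar> * (1 / 2) \<le> \<bar>r\<bar> * \<bar>Re (\<phi> (F y))\<bar>" by (rule mult_left_mono) simp
    also have "\<dots> = \<bar>Re (V y)\<bar>" using c(1) by (simp add: V_def indicator_def abs_mult)
    also have "\<dots> \<le> norm (V y)" by (rule abs_Re_le_cmod)
    finally show ?thesis by simp
  qed
  have "B - B' \<subseteq> {x \<in> space M. 1 / 2 \<le> norm (U x)} \<union> {x \<in> space M. 1 / 2 \<le> norm (V x)}"
    by (auto simp: B'_def space_M)
  then have "emeasure M (B - B')
      \<le> emeasure M ({x \<in> space M. 1 / 2 \<le> norm (U x)} \<union> {x \<in> space M. 1 / 2 \<le> norm (V x)})"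
    by (rule emeasure_mono) measurable
  also have "\<dots> \<le> emeasure M {x \<in> space M. 1 / 2 \<le> norm (U x)} + emeasure M {x \<in> space M. 1 / 2 \<le> norm (V x)}"
    by (rule emeasure_subadditive) measurable
  also have "\<dots> < ennreal ((\<delta> / (1 / 2)) powr p) + ennreal ((\<delta> / (1 / 2)) powr p)"
    by (intro add_strict_mono Markov[OF U] Markov[OF V]) auto
  also have "\<dots> = ennreal (2 * (2 * \<delta>) powr p)"
    by (simp add: mult.commute flip: ennreal_plus)
  finally have 1: "emeasure M (B - B') < ennreal (2 * (2 * \<delta>) powr p)" .
  have "emeasure M (F ` B') < ennreal ((\<delta> / (1 / (2 * \<bar>r\<bar>))) powr p)"
    using image_funpow_sets[OF B', of k] r far_U by (intro Markov[OF U]) (auto simp: F_def)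
  also have "(\<delta> / (1 / (2 * \<bar>r\<bar>))) powr p = \<bar>r\<bar> powr p * (2 * \<delta>) powr p"
    by (simp add: mult_ac flip: powr_mult)
  finally have 2: "emeasure M (F ` B') < ennreal (\<bar>r\<bar> powr p * (2 * \<delta>) powr p)" .
  have "emeasure M (F -` B') < ennreal ((\<delta> / (\<bar>r\<bar> / 2)) powr p)"
    using vimage_funpow_sets[OF B', of k] r far_V by (intro Markov[OF V]) (auto simp: F_def)
  also have "(\<delta> / (\<bar>r\<bar> / 2)) powr p = \<bar>r\<bar> powr (- p) * (2 * \<delta>) powr p"
    using \<delta> r by (simp add: powr_divide powr_mult powr_minus field_simps)
  finally have 3: "emeasure M (F -` B') < ennreal (\<bar>r\<bar> powr (- p) * (2 * \<delta>) powr p)" .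
  show ?thesis
    using that[OF B' _ 1 2[unfolded F_def] 3[unfolded F_def]] by (auto simp: B'_def)
qed

text \<open>Once the two approximations are found, it remains to ensure that the scalars are nonzero
  and that \<open>k\<close> is positive. Both follow when the measure of \<open>B\<close> is at
  least \<open>\<epsilon>\<close>; otherwise the empty set serves as \<open>B'\<close>.\<close>

lemma real_supercyclic_imp_small_images:
  assumes p: "1 \<le> p"
    and cyc: "real_supercyclic (Lp p M) (Lp_dist p M) (Lp_scaleR p M) (Lp_comp p M f)"
    and \<epsilon>: "(\<epsilon> :: real) > 0" and B[measurable]: "B \<in> sets M" and fin: "emeasure M B < \<infinity>"
  shows "\<exists>B' k. \<exists>r::real. B' \<in> sets M \<and> B' \<subseteq> B \<and> k \<ge> (1::nat) \<and> r > 0 \<and>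
        emeasure M (B - B') < ennreal \<epsilon> \<and>
        emeasure M ((f ^^ k) ` B') < ennreal (r powr p * \<epsilon>) \<and>
        emeasure M ((f ^^ k) -` B') < ennreal (r powr (- p) * \<epsilon>)"
proof (cases "emeasure M B < ennreal \<epsilon>")
  case True
  then show ?thesis using \<epsilon> by (intro exI[of _ "{}"] exI[of _ 1]) auto
next
  case False
  obtain a where a: "a \<in> Lp p M" and dense:
    "Metric_space.mtopology (Lp p M) (Lp_dist p M) closure_of
      {Lp_scaleR p M r ((Lp_comp p M f ^^ n) a) | n r. True} = Lp p M"
    using cyc unfolding real_supercyclic_def by (rule bexE)
  define \<xi> where "\<xi> = Lp_rep a"
  have \<xi>: "\<xi> \<in> Lp_functions p M" "a = Lp_class p M \<xi>"
    using Lp_rep[OF a] by (simp_all add: \<xi>_def)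
  have orbit: "\<exists>n r. Lp_norm p M (\<lambda>x. r *\<^sub>R \<xi> ((f ^^ n) x) - \<psi> x) < \<delta>"
    if \<psi>: "\<psi> \<in> Lp_functions p M" and "0 < \<delta>" for \<psi> \<delta>
  proof -
    have sub: "{Lp_scaleR p M r ((Lp_comp p M f ^^ n) a) | n r. True} \<subseteq> Lp p M"
      using orbit_in_Lp[OF a] by auto
    have "\<exists>b\<in>{Lp_scaleR p M r ((Lp_comp p M f ^^ n) a) | n r. True}. Lp_dist p M (Lp_class p M \<psi>) b < \<delta>"
      using dense[unfolded closure_of_Lp_iff[OF p sub]] Lp_class_in_Lp[OF \<psi>] \<open>0 < \<delta>\<close> by simp
    then obtain n r where near:
      "Lp_dist p M (Lp_class p M \<psi>) (Lp_scaleR p M r ((Lp_comp p M f ^^ n) a)) < \<delta>"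
      by auto
    have "Lp_dist p M (Lp_class p M \<psi>) (Lp_scaleR p M r ((Lp_comp p M f ^^ n) a))
        = Lp_norm p M (\<lambda>x. \<psi> x - r *\<^sub>R \<xi> ((f ^^ n) x))"
      unfolding \<xi>(2) Lp_scaleR_comp_funpow_class[OF \<xi>(1)]
      by (rule Lp_dist_class[OF p \<psi> Lp_functions_scaleR[OF Lp_functions_comp_funpow[OF \<xi>(1)]]])
    also have "\<dots> = Lp_norm p M (\<lambda>x. r *\<^sub>R \<xi> ((f ^^ n) x) - \<psi> x)"
      by (rule Lp_norm_minus_commute)
    finally have "Lp_norm p M (\<lambda>x. r *\<^sub>R \<xi> ((f ^^ n) x) - \<psi> x) < \<delta>"
      using near by simp
    then show ?thesis by blast
  qed
  have ind: "(\<lambda>x. b * indicator B x) \<in> Lp_functions p M" for b :: complex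
    using fin by (intro Lp_indicator_finite_measure(1)[OF p B, of "measure M B"])
      (auto simp: emeasure_eq_ennreal_measure)
  \<comment> \<open>Chosen so that \<open>(2 * \<delta>) powr p = \<epsilon> / 4\<close>. The slack
    against \<open>\<epsilon>\<close> is what excludes \<open>k = 0\<close> below.\<close>
  define \<delta> where "\<delta> = (\<epsilon> / 4) powr (1 / p) / 2"
  have \<delta>: "0 < \<delta>" using \<epsilon> by (simp add: \<delta>_def)
  have two_\<delta>: "(2 * \<delta>) powr p = \<epsilon> / 4"
    using \<epsilon> p by (simp add: \<delta>_def powr_powr)
  obtain n1 r1 where 1: "Lp_norm p M (\<lambda>x. r1 *\<^sub>R \<xi> ((f ^^ n1) x) - 1 * indicator B x) < \<delta>"
    using orbit[OF ind \<delta>] by blast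
  obtain n2 r2 where 2: "Lp_norm p M (\<lambda>x. r2 *\<^sub>R \<xi> ((f ^^ n2) x) - \<i> * indicator B x) < \<delta>"
    using orbit[OF ind \<delta>] by blast
  have nonzero: "r \<noteq> 0" if "Lp_norm p M (\<lambda>x. r *\<^sub>R \<xi> ((f ^^ n) x) - b * indicator B x) < \<delta>" "norm b = 1"
    for r n b
  proof
    assume "r = 0"
    \<comment> \<open>A zero scalar would make the norm of the indicator itself small, hence the
      measure of \<open>B\<close> less than \<open>\<epsilon>\<close>.\<close>
    with that have *: "Lp_norm p M (\<lambda>x. b * indicator B x) < \<delta>" by (simp add: Lp_norm_uminus)
    have "emeasure M B \<le> ennreal ((Lp_norm p M (\<lambda>x. b * indicator B x) / 1) powr p)"
      using \<open>norm b = 1\<close> by (intro Lp_Markov_inequality[OF p ind B]) (auto simp: norm_mult)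
    also have "\<dots> \<le> ennreal ((2 * \<delta>) powr p)"
      using * \<delta> p by (intro ennreal_leI powr_mono2) (auto simp: Lp_norm_nonneg)
    also have "\<dots> < ennreal \<epsilon>" using two_\<delta> \<epsilon> by (simp add: ennreal_lessI)
    finally show False using False by simp
  qed
  have r1: "r1 \<noteq> 0" using nonzero[OF 1] by simp
  have r2: "r2 \<noteq> 0" using nonzero[OF 2] by simp
  have "\<exists>\<phi> k r c. \<phi> \<in> Lp_functions p M \<and> r \<noteq> 0 \<and> Re c = 0 \<and> \<bar>Im c\<bar> = 1 \<and>
      Lp_norm p M (\<lambda>x. \<phi> x - indicator B x) < \<delta> \<and>
      Lp_norm p M (\<lambda>x. r *\<^sub>R \<phi> ((f ^^ k) x) - c * indicator B x) < \<delta>"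
  proof (cases "n1 \<le> n2")
    case True
    have "(f ^^ n1) ((f ^^ (n2 - n1)) x) = (f ^^ n2) x" for x
      using True by (metis comp_apply funpow_add le_add_diff_inverse)
    then have *: "(r2 / r1) *\<^sub>R (r1 *\<^sub>R \<xi> ((f ^^ n1) ((f ^^ (n2 - n1)) x))) = r2 *\<^sub>R \<xi> ((f ^^ n2) x)" for x
      using r1 by simp
    show ?thesis
      by (rule exI[of _ "\<lambda>x. r1 *\<^sub>R \<xi> ((f ^^ n1) x)"], rule exI[of _ "n2 - n1"], rule exI[of _ "r2 / r1"],
          rule exI[of _ \<i>], unfold *)
        (use 1 2 r1 r2 \<xi>(1) in \<open>simp add: Lp_functions_scaleR Lp_functions_comp_funpow\<close>)
  next
    case False
    \<comment> \<open>The iterate close to \<open>\<i>\<close> times the indicator comes first.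
      Multiplying by \<open>- \<i>\<close> turns it into an approximation of the indicator, and the
      target of the later iterate becomes \<open>- \<i>\<close>.\<close>
    let ?\<phi> = "\<lambda>x. - \<i> * (r2 *\<^sub>R \<xi> ((f ^^ n2) x))"
    have Lp: "?\<phi> \<in> Lp_functions p M"
      by (rule Lp_functions_cmult[OF Lp_functions_scaleR[OF Lp_functions_comp_funpow[OF \<xi>(1)]]])
    have "(\<lambda>x. ?\<phi> x - indicator B x) = (\<lambda>x. - \<i> * (r2 *\<^sub>R \<xi> ((f ^^ n2) x) - \<i> * indicator B x))"
      by (simp add: algebra_simps)
    then have u: "Lp_norm p M (\<lambda>x. ?\<phi> x - indicator B x) < \<delta>"
      using 2 by (simp only: Lp_norm_cmult[OF p]) simp
    have *: "(f ^^ n2) ((f ^^ (n1 - n2)) x) = (f ^^ n1) x" for x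
      using False by (metis comp_apply funpow_add le_add_diff_inverse nat_le_linear)
    have "(\<lambda>x. (r1 / r2) *\<^sub>R ?\<phi> ((f ^^ (n1 - n2)) x) - (- \<i>) * indicator B x)
        = (\<lambda>x. - \<i> * (r1 *\<^sub>R \<xi> ((f ^^ n1) x) - 1 * indicator B x))"
      unfolding * using r2 by (simp add: algebra_simps)
    then have v: "Lp_norm p M (\<lambda>x. (r1 / r2) *\<^sub>R ?\<phi> ((f ^^ (n1 - n2)) x) - (- \<i>) * indicator B x) < \<delta>"
      using 1 by (simp only: Lp_norm_cmult[OF p]) simp
    show ?thesis
      by (rule exI[of _ ?\<phi>], rule exI[of _ "n1 - n2"], rule exI[of _ "r1 / r2"], rule exI[of _ "- \<i>"],
          intro conjI u v Lp) (use r1 r2 in simp_all)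
  qed
  then obtain \<phi> k r c where \<phi>: "\<phi> \<in> Lp_functions p M" "Re c = 0" "\<bar>Im c\<bar> = 1" "r \<noteq> 0"
      "Lp_norm p M (\<lambda>x. \<phi> x - indicator B x) < \<delta>"
      "Lp_norm p M (\<lambda>x. r *\<^sub>R \<phi> ((f ^^ k) x) - c * indicator B x) < \<delta>"
    by blast
  obtain B' where B': "B' \<in> sets M" "B' \<subseteq> B"
    "emeasure M (B - B') < ennreal (2 * (2 * \<delta>) powr p)"
    "emeasure M ((f ^^ k) ` B') < ennreal (\<bar>r\<bar> powr p * (2 * \<delta>) powr p)"
    "emeasure M ((f ^^ k) -` B') < ennreal (\<bar>r\<bar> powr (- p) * (2 * \<delta>) powr p)"
    by (rule approximation_imp_small_images[OF p \<phi>(1) B fin \<phi>(2-6)])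
  have "k \<noteq> 0"
  proof
    assume "k = 0"
    \<comment> \<open>For \<open>k = 0\<close> image and preimage are both \<open>B'\<close>, and
      one of the two reciprocal factors is at most 1. So \<open>B'\<close> has measure below
      \<open>\<epsilon> / 4\<close>, and \<open>B\<close> has measure below
      \<open>\<epsilon>\<close>.\<close>
    consider "\<bar>r\<bar> powr p \<le> 1" | "\<bar>r\<bar> powr (- p) \<le> 1"
      by (cases "\<bar>r\<bar> powr p \<le> 1") (auto simp: powr_minus inverse_le_1_iff)
    then have small: "emeasure M B' < ennreal (\<epsilon> / 4)"
    proof cases
      case 1
      have "emeasure M B' < ennreal (\<bar>r\<bar> powr p * (\<epsilon> / 4))"
        using B'(4) \<open>k = 0\<close> two_\<delta> by simp
      also have "\<dots> \<le> ennreal (\<epsilon> / 4)"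
        using 1 \<epsilon> by (intro ennreal_leI mult_left_le_one_le) auto
      finally show ?thesis .
    next
      case 2
      have "emeasure M B' < ennreal (\<bar>r\<bar> powr (- p) * (\<epsilon> / 4))"
        using B'(5) \<open>k = 0\<close> two_\<delta> by simp
      also have "\<dots> \<le> ennreal (\<epsilon> / 4)"
        using 2 \<epsilon> by (intro ennreal_leI mult_left_le_one_le) auto
      finally show ?thesis .
    qed
    have "emeasure M B = emeasure M (B - B') + emeasure M B'"
      using B'(1,2) by (subst plus_emeasure) (auto simp: Un_absorb2)
    also have "\<dots> < ennreal (\<epsilon> / 2) + ennreal (\<epsilon> / 4)"
      using B'(3) small two_\<delta> by (intro add_strict_mono) auto
    also have "\<dots> < ennreal \<epsilon>"
      using \<epsilon> by (simp add: ennreal_lessI flip: ennreal_plus)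
    finally show False using False by simp
  qed
  have le: "ennreal (s * (2 * \<delta>) powr p) \<le> ennreal (s * \<epsilon>)" if "0 \<le> s" for s
    unfolding two_\<delta> using that \<epsilon> by (intro ennreal_leI mult_left_mono) auto
  have "emeasure M (B - B') < ennreal \<epsilon>"
    using B'(3) by (rule less_le_trans) (use two_\<delta> \<epsilon> in \<open>auto intro: ennreal_leI\<close>)
  moreover have "emeasure M ((f ^^ k) ` B') < ennreal (\<bar>r\<bar> powr p * \<epsilon>)"
    using B'(4) by (rule less_le_trans) (simp add: le)
  moreover have "emeasure M ((f ^^ k) -` B') < ennreal (\<bar>r\<bar> powr (- p) * \<epsilon>)"
    using B'(5) by (rule less_le_trans) (simp add: le)
  ultimately show ?thesis
    using B'(1,2) \<open>k \<noteq> 0\<close> \<phi>(4)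
    by (intro exI[of _ B'] exI[of _ k] exI[of _ "\<bar>r\<bar>"]) simp
qed

section \<open>From small images to transitivity\<close>

text \<open>Cutting \<open>\<phi>\<close> and \<open>\<psi>\<close> down to \<open>B'\<close> costs
  little because \<open>B - B'\<close> is small. Transporting the two pieces by
  \<open>f ^^ k\<close> and its inverse moves them onto the preimage and the image of
  \<open>B'\<close>, whose small measures absorb the factors \<open>r\<close> and
  \<open>1 / r\<close>.\<close>

lemma small_images_imp_transitive:
  assumes p: "1 \<le> p"
    and small: "\<And>(\<epsilon>::real) B. \<epsilon> > 0 \<Longrightarrow> B \<in> sets M \<Longrightarrow> emeasure M B < \<infinity> \<Longrightarrow>
      \<exists>B' k. \<exists>r::real. B' \<in> sets M \<and> B' \<subseteq> B \<and> r > 0 \<and>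
        emeasure M (B - B') < ennreal \<epsilon> \<and>
        emeasure M ((f ^^ k) ` B') < ennreal (r powr p * \<epsilon>) \<and>
        emeasure M ((f ^^ k) -` B') < ennreal (r powr (- p) * \<epsilon>)"
    and u: "u \<in> Lp_functions p M" and v: "v \<in> Lp_functions p M" and \<delta>: "0 < \<delta>"
  shows "\<exists>w k r. w \<in> Lp_functions p M \<and> Lp_norm p M (\<lambda>x. w x - u x) < \<delta> \<and>
    Lp_norm p M (\<lambda>x. r *\<^sub>R w ((f ^^ k) x) - v x) < \<delta>"
proof -
  have half: "0 < \<delta> / 2" using \<delta> by simp
  obtain \<phi> where \<phi>: "simple_function M \<phi>" "\<phi> \<in> Lp_functions p M" "Lp_norm p M (\<lambda>x. u x - \<phi> x) < \<delta> / 2"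
    by (rule Lp_simple_function_dense[OF p u half])
  obtain \<psi> where \<psi>: "simple_function M \<psi>" "\<psi> \<in> Lp_functions p M" "Lp_norm p M (\<lambda>x. v x - \<psi> x) < \<delta> / 2"
    by (rule Lp_simple_function_dense[OF p v half])
  obtain C1 where C1: "0 < C1" "\<And>x. x \<in> space M \<Longrightarrow> norm (\<phi> x) \<le> C1"
    by (rule simple_function_bounded[OF \<phi>(1)]) (rule that)
  obtain C2 where C2: "0 < C2" "\<And>x. x \<in> space M \<Longrightarrow> norm (\<psi> x) \<le> C2"
    by (rule simple_function_bounded[OF \<psi>(1)]) (rule that)
  define C where "C = max C1 C2"
  have C: "0 < C" "norm (\<phi> x) \<le> C" "norm (\<psi> x) \<le> C" for x
    using C1 C2 by (auto simp: C_def space_M le_max_iff_disj)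
  note supp = simple_function_Lp_support[OF p \<phi>(1,2)] simple_function_Lp_support[OF p \<psi>(1,2)]
  define B where "B = {x \<in> space M. \<phi> x \<noteq> 0} \<union> {x \<in> space M. \<psi> x \<noteq> 0}"
  have B: "B \<in> sets M" unfolding B_def using supp(1,3) by (rule sets.Un)
  have "emeasure M B \<le> emeasure M {x \<in> space M. \<phi> x \<noteq> 0} + emeasure M {x \<in> space M. \<psi> x \<noteq> 0}"
    unfolding B_def using supp(1,3) by (rule emeasure_subadditive)
  also have "\<dots> < \<infinity>" using supp(2,4) by simp
  finally have fin: "emeasure M B < \<infinity>" .
  \<comment> \<open>A function bounded by \<open>C\<close> on a set of measure at most
    \<open>e\<close>, and zero elsewhere, has norm at most \<open>\<delta> / 4\<close>.\<close>
  define e where "e = (\<delta> / (4 * C)) powr p"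
  have e: "0 < e" using \<delta> C(1) by (simp add: e_def)
  have e_root: "e powr (1 / p) = \<delta> / (4 * C)"
    unfolding e_def using \<delta> C(1) p by (intro powr_powr_inverse) auto
  obtain B' k and r :: real where B'[measurable]: "B' \<in> sets M" and "B' \<subseteq> B" and r: "r > 0"
    and small: "emeasure M (B - B') < ennreal e"
      "emeasure M ((f ^^ k) ` B') < ennreal (r powr p * e)"
      "emeasure M ((f ^^ k) -` B') < ennreal (r powr (- p) * e)"
    using small[OF e B fin] by blast
  note [measurable] = B
  define F where "F = f ^^ k"
  define G where "G = inv F"
  have [measurable]: "F \<in> measurable M M" "G \<in> measurable M M"
    unfolding F_def G_def by (rule measurable_funpow measurable_inv_funpow)+
  have FG: "F (G x) = x" "G (F x) = x" for x
    using bij_funpow[of k] unfolding F_def G_def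
    by (simp_all add: surj_f_inv_f inv_f_f bij_is_surj bij_is_inj)
  note [measurable] = Lp_functions_measurable[OF \<phi>(2)] Lp_functions_measurable[OF \<psi>(2)]
  \<comment> \<open>\<open>t1\<close> and \<open>t4\<close> are the parts cut off from
    \<open>\<phi>\<close> and \<open>\<psi>\<close>. \<open>t2\<close> is the rest of
    \<open>\<psi>\<close> moved back by the inverse iterate, and \<open>t3\<close> the rest of
    \<open>\<phi>\<close> composed with the iterate.\<close>
  define t1 where "t1 x = indicator (B - B') x * \<phi> x" for x
  define t2 where "t2 x = indicator B' (G x) * \<psi> (G x)" for x
  define t3 where "t3 x = indicator B' (F x) * \<phi> (F x)" for x
  define t4 where "t4 x = indicator (B - B') x * \<psi> x" for x
  have root2: "C * (r powr p * e) powr (1 / p) = r * (\<delta> / 4)"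
    using r p e C(1) by (simp add: powr_mult powr_powr e_root)
  have root3: "C * (r powr (- p) * e) powr (1 / p) = (1 / r) * (\<delta> / 4)"
  proof -
    have "- p * (1 / p) = - 1" using p by simp
    then have "(r powr (- p)) powr (1 / p) = 1 / r"
      using r by (simp only: powr_powr) (simp add: powr_minus_divide)
    then show ?thesis
      using C(1) by (simp only: powr_mult e_root) simp
  qed
  have t1: "t1 \<in> Lp_functions p M" "Lp_norm p M t1 \<le> \<delta> / 4"
    using Lp_norm_bounded_support[OF p _ _ less_imp_le[OF small(1)], of t1 C] e C
    by (auto simp: t1_def[abs_def] e_root indicator_def)
  have t4: "t4 \<in> Lp_functions p M" "Lp_norm p M t4 \<le> \<delta> / 4"
    using Lp_norm_bounded_support[OF p _ _ less_imp_le[OF small(1)], of t4 C] e C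
    by (auto simp: t4_def[abs_def] e_root indicator_def)
  have t2: "t2 \<in> Lp_functions p M" "Lp_norm p M t2 \<le> r * (\<delta> / 4)"
  proof -
    have m: "t2 \<in> borel_measurable M" unfolding t2_def by measurable
    have *: "t2 x = 0" if "x \<notin> (f ^^ k) ` B'" for x
    proof -
      have "G x \<notin> B'"
      proof
        assume "G x \<in> B'"
        then have "F (G x) \<in> F ` B'" by (rule imageI)
        then show False using that unfolding FG(1) unfolding F_def by simp
      qed
      then show ?thesis by (simp add: t2_def)
    qed
    have **: "norm (t2 x) \<le> C" for x
      using C by (auto simp: t2_def indicator_def less_imp_le)
    have nonneg: "0 \<le> r powr p * e" using e by simp
    show "t2 \<in> Lp_functions p M" "Lp_norm p M t2 \<le> r * (\<delta> / 4)"
      using Lp_norm_bounded_support[OF p m image_funpow_sets[OF B'] less_imp_le[OF small(2)] nonneg, of C]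
        * ** C(1) unfolding root2 by (auto simp: less_imp_le)
  qed
  have t3: "t3 \<in> Lp_functions p M" "Lp_norm p M t3 \<le> (1 / r) * (\<delta> / 4)"
  proof -
    have m: "t3 \<in> borel_measurable M" unfolding t3_def by measurable
    have *: "t3 x = 0" if "x \<notin> (f ^^ k) -` B'" for x
      using that by (auto simp: t3_def indicator_def F_def)
    have **: "norm (t3 x) \<le> C" for x
      using C by (auto simp: t3_def indicator_def less_imp_le)
    have nonneg: "0 \<le> r powr (- p) * e" using e by simp
    show "t3 \<in> Lp_functions p M" "Lp_norm p M t3 \<le> (1 / r) * (\<delta> / 4)"
      using Lp_norm_bounded_support[OF p m vimage_funpow_sets[OF B'] less_imp_le[OF small(3)] nonneg, of C]
        * ** C(1) unfolding root3 by (auto simp: less_imp_le)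
  qed
  define w where "w x = (\<phi> x - t1 x) + (1 / r) *\<^sub>R t2 x" for x
  have w: "w \<in> Lp_functions p M"
    unfolding w_def[abs_def]
    by (rule Lp_functions_add[OF p Lp_functions_diff[OF p \<phi>(2) t1(1)] Lp_functions_scaleR[OF t2(1)]])
  have split: "\<phi> x - t1 x = indicator B' x * \<phi> x" "\<psi> x - t4 x = indicator B' x * \<psi> x" for x
    using \<open>B' \<subseteq> B\<close> by (auto simp: t1_def t4_def B_def space_M indicator_def)
  have "(\<lambda>x. w x - u x) = (\<lambda>x. ((\<phi> x - u x) - t1 x) + (1 / r) *\<^sub>R t2 x)"
    by (simp add: w_def fun_eq_iff)
  then have "Lp_norm p M (\<lambda>x. w x - u x)
      \<le> Lp_norm p M (\<lambda>x. \<phi> x - u x) + Lp_norm p M t1 + \<bar>1 / r\<bar> * Lp_norm p M t2"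
    using Lp_norm_triangle3[OF p Lp_functions_diff[OF p \<phi>(2) u] t1(1) t2(1)] by (simp only:)
  also have "\<dots> < \<delta> / 2 + \<delta> / 4 + \<bar>1 / r\<bar> * (r * (\<delta> / 4))"
    using \<phi>(3) t1(2) t2(2) unfolding Lp_norm_minus_commute[of p M \<phi> u]
    by (intro add_less_le_mono mult_left_mono) auto
  also have "\<dots> = \<delta>" using r by simp
  finally have 1: "Lp_norm p M (\<lambda>x. w x - u x) < \<delta>" .
  \<comment> \<open>Composition with \<open>F\<close> undoes \<open>G\<close> in \<open>t2\<close>,
    and the scalar \<open>r\<close> cancels \<open>1 / r\<close>. What remains is
    \<open>\<psi>\<close> without \<open>t4\<close>, disturbed only by \<open>t3\<close>.\<close>
  have "r *\<^sub>R w (F x) = r *\<^sub>R t3 x + (\<psi> x - t4 x)" for x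
  proof -
    have "w (F x) = t3 x + (1 / r) *\<^sub>R (\<psi> x - t4 x)"
      unfolding w_def split by (simp add: t2_def t3_def FG)
    then show ?thesis using r by (simp add: scaleR_add_right)
  qed
  then have "(\<lambda>x. r *\<^sub>R w (F x) - v x) = (\<lambda>x. ((\<psi> x - v x) - t4 x) + r *\<^sub>R t3 x)"
    by (simp add: fun_eq_iff)
  then have "Lp_norm p M (\<lambda>x. r *\<^sub>R w (F x) - v x)
      \<le> Lp_norm p M (\<lambda>x. \<psi> x - v x) + Lp_norm p M t4 + \<bar>r\<bar> * Lp_norm p M t3"
    using Lp_norm_triangle3[OF p Lp_functions_diff[OF p \<psi>(2) v] t4(1) t3(1)] by (simp only:)
  also have "\<dots> < \<delta> / 2 + \<delta> / 4 + \<bar>r\<bar> * ((1 / r) * (\<delta> / 4))"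
    using \<psi>(3) t4(2) t3(2) unfolding Lp_norm_minus_commute[of p M \<psi> v]
    by (intro add_less_le_mono mult_left_mono) auto
  also have "\<dots> = \<delta>" using r by simp
  finally have 2: "Lp_norm p M (\<lambda>x. r *\<^sub>R w (F x) - v x) < \<delta>" .
  show ?thesis using w 1 2 unfolding F_def by blast
qed

section \<open>Birkhoff's transitivity argument\<close>

text \<open>A class is supercyclic if its scaled orbit comes arbitrarily close to each member of a
  countable dense set. This is a countable intersection of conditions that are open by continuity
  and dense by transitivity.\<close>

lemma transitive_imp_real_supercyclic:
  assumes p: "1 \<le> p"
    and trans: "\<And>u v \<delta>. u \<in> Lp_functions p M \<Longrightarrow> v \<in> Lp_functions p M \<Longrightarrow> 0 < \<delta> \<Longrightarrow>
      \<exists>w k r. w \<in> Lp_functions p M \<and> Lp_norm p M (\<lambda>x. w x - u x) < \<delta> \<and>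
        Lp_norm p M (\<lambda>x. r *\<^sub>R w ((f ^^ k) x) - v x) < \<delta>"
  shows "real_supercyclic (Lp p M) (Lp_dist p M) (Lp_scaleR p M) (Lp_comp p M f)"
proof -
  interpret Metric_space "Lp p M" "Lp_dist p M" by (rule Metric_space_Lp[OF p])
  obtain D where D: "countable D" "D \<subseteq> Lp_functions p M"
    "\<And>\<phi> \<delta>. \<phi> \<in> Lp_functions p M \<Longrightarrow> 0 < \<delta> \<Longrightarrow> \<exists>g\<in>D. Lp_norm p M (\<lambda>x. \<phi> x - g x) < \<delta>"
    by (rule Lp_separable[OF p]) (rule that)
  define T where "T r k a = Lp_scaleR p M r ((Lp_comp p M f ^^ k) a)" for r k a
  have T_Lp: "T r k a \<in> Lp p M" if "a \<in> Lp p M" for r k a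
    unfolding T_def by (rule orbit_in_Lp[OF that])
  have T_class: "T r k (Lp_class p M \<phi>) = Lp_class p M (\<lambda>x. r *\<^sub>R \<phi> ((f ^^ k) x))"
    if "\<phi> \<in> Lp_functions p M" for r k \<phi>
    unfolding T_def by (rule Lp_scaleR_comp_funpow_class[OF that])
  define V where "V g n = {a \<in> Lp p M. \<exists>r k. Lp_dist p M (T r k a) (Lp_class p M g) < 1 / (real n + 1)}" for g n
  have V_open: "openin mtopology (V g n)" if g: "g \<in> D" for g n
    unfolding openin_mtopology
  proof (intro conjI allI impI)
    show "V g n \<subseteq> Lp p M" by (auto simp: V_def)
    have g_Lp: "Lp_class p M g \<in> Lp p M" using g D(2) by (intro Lp_class_in_Lp) auto
    fix a assume "a \<in> V g n"
    then obtain r k where a: "a \<in> Lp p M" and near: "Lp_dist p M (T r k a) (Lp_class p M g) < 1 / (real n + 1)"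
      by (auto simp: V_def)
    obtain C where C: "0 \<le> C" "\<And>a b. a \<in> Lp p M \<Longrightarrow> b \<in> Lp p M \<Longrightarrow>
        Lp_dist p M (T r k a) (T r k b) \<le> C * Lp_dist p M a b"
      using Lp_dist_scaleR_comp_le[OF p, of r k] unfolding T_def by blast
    define \<eta> where "\<eta> = 1 / (real n + 1) - Lp_dist p M (T r k a) (Lp_class p M g)"
    have \<eta>: "0 < \<eta>" using near by (simp add: \<eta>_def)
    \<comment> \<open>The radius uses \<open>C + 1\<close> because \<open>C\<close> may be
      0.\<close>
    have "mball a (\<eta> / (C + 1)) \<subseteq> V g n"
    proof
      fix b assume "b \<in> mball a (\<eta> / (C + 1))"
      then have b: "b \<in> Lp p M" "Lp_dist p M a b < \<eta> / (C + 1)" by (auto simp: in_mball)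
      have "Lp_dist p M (T r k b) (T r k a) = Lp_dist p M (T r k a) (T r k b)"
        by (rule commute)
      also have "\<dots> \<le> C * Lp_dist p M a b"
        by (rule C(2)[OF a b(1)])
      also have "\<dots> \<le> (C + 1) * Lp_dist p M a b"
        by (rule mult_right_mono) simp_all
      also have "\<dots> < \<eta>"
        using b(2) C(1) by (simp add: pos_less_divide_eq mult.commute)
      finally have "Lp_dist p M (T r k b) (Lp_class p M g) < 1 / (real n + 1)"
        using triangle[OF T_Lp[OF b(1)] T_Lp[OF a] g_Lp, of r k r k] by (simp add: \<eta>_def)
      then show "b \<in> V g n" using b(1) by (auto simp: V_def)
    qed
    moreover have "0 < \<eta> / (C + 1)" using \<eta> C(1) by simp
    ultimately show "\<exists>\<rho>>0. mball a \<rho> \<subseteq> V g n" by blast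
  qed
  have V_dense: "mtopology closure_of (V g n) = Lp p M" if g: "g \<in> D" for g n
  proof -
    have sub: "V g n \<subseteq> Lp p M" by (auto simp: V_def)
    show ?thesis
      unfolding closure_of_Lp_iff[OF p sub]
    proof (intro ballI allI impI)
      fix a :: "('a \<Rightarrow> complex) set" and \<delta> :: real
      assume a: "a \<in> Lp p M" and "0 < \<delta>"
      have g_Lp: "g \<in> Lp_functions p M" using g D(2) by auto
      \<comment> \<open>One tolerance serves both for closeness to \<open>a\<close> and for
        membership in \<open>V g n\<close>.\<close>
      have "0 < min \<delta> (1 / (real n + 1))" using \<open>0 < \<delta>\<close> by simp
      from trans[OF Lp_rep(1)[OF a] g_Lp this] obtain w k r where w: "w \<in> Lp_functions p M"
        "Lp_norm p M (\<lambda>x. w x - Lp_rep a x) < min \<delta> (1 / (real n + 1))"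
        "Lp_norm p M (\<lambda>x. r *\<^sub>R w ((f ^^ k) x) - g x) < min \<delta> (1 / (real n + 1))"
        by (elim exE conjE)
      have "Lp_dist p M (T r k (Lp_class p M w)) (Lp_class p M g) = Lp_norm p M (\<lambda>x. r *\<^sub>R w ((f ^^ k) x) - g x)"
        unfolding T_class[OF w(1)]
        by (rule Lp_dist_class[OF p Lp_functions_scaleR[OF Lp_functions_comp_funpow[OF w(1)]] g_Lp])
      then have "Lp_dist p M (T r k (Lp_class p M w)) (Lp_class p M g) < 1 / (real n + 1)"
        using w(3) by simp
      then have "Lp_class p M w \<in> V g n"
        using Lp_class_in_Lp[OF w(1)] by (auto simp: V_def)
      moreover have "Lp_dist p M (Lp_class p M w) a < \<delta>"
        using Lp_dist_class[OF p w(1) Lp_rep(1)[OF a]] w(2) by (simp add: Lp_rep(2)[OF a])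
      then have "Lp_dist p M a (Lp_class p M w) < \<delta>" by (simp add: commute)
      ultimately show "\<exists>b\<in>V g n. Lp_dist p M a b < \<delta>" by blast
    qed
  qed
  let ?\<V> = "(\<lambda>(g, n). V g n) ` (D \<times> UNIV)"
  have "mtopology closure_of \<Inter>?\<V> = Lp p M"
  proof (rule metric_Baire_category[OF mcomplete_Lp[OF p]])
    show "countable ?\<V>" using D(1) by simp
    show "openin mtopology S \<and> mtopology closure_of S = Lp p M" if "S \<in> ?\<V>" for S
      using that V_open V_dense by auto
  qed
  moreover have "Lp_class p M (\<lambda>x. 0) \<in> Lp p M"
    by (intro Lp_class_in_Lp) (simp add: Lp_functions_def)
  ultimately have "Lp_class p M (\<lambda>x. 0) \<in> mtopology closure_of \<Inter>?\<V>" by (simp only:)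
  \<comment> \<open>Only nonemptiness of the intersection is wanted; taking the point in a ball also
    places it in \<open>Lp p M\<close>.\<close>
  then have "\<exists>b\<in>\<Inter>?\<V>. b \<in> mball (Lp_class p M (\<lambda>x. 0)) 1"
    unfolding metric_closure_of mem_Collect_eq using zero_less_one by blast
  then obtain a where a: "a \<in> Lp p M" "\<And>g n. g \<in> D \<Longrightarrow> a \<in> V g n"
    by (auto simp: in_mball)
  let ?orbit = "{T r n a | n r. True}"
  have sub: "?orbit \<subseteq> Lp p M" using T_Lp[OF a(1)] by auto
  have "mtopology closure_of ?orbit = Lp p M"
    unfolding closure_of_Lp_iff[OF p sub]
  proof (intro ballI allI impI)
    fix b :: "('a \<Rightarrow> complex) set" and \<delta> :: real
    assume b: "b \<in> Lp p M" and \<delta>: "0 < \<delta>"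
    obtain g where g: "g \<in> D" "Lp_norm p M (\<lambda>x. Lp_rep b x - g x) < \<delta> / 2"
      using D(3)[OF Lp_rep(1)[OF b], of "\<delta> / 2"] \<delta> by auto
    have g_Lp: "g \<in> Lp_functions p M" using g(1) D(2) by auto
    have bg: "Lp_dist p M b (Lp_class p M g) < \<delta> / 2"
      using Lp_dist_class[OF p Lp_rep(1)[OF b] g_Lp] g(2) by (simp add: Lp_rep(2)[OF b])
    obtain n where "inverse (real (Suc n)) < \<delta> / 2"
      using reals_Archimedean[OF half_gt_zero[OF \<delta>]] by blast
    then have n: "1 / (real n + 1) < \<delta> / 2"
      by (simp add: inverse_eq_divide add.commute)
    obtain r k where rk: "Lp_dist p M (T r k a) (Lp_class p M g) < 1 / (real n + 1)"
      using a(2)[OF g(1), of n] by (auto simp: V_def)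
    have "Lp_dist p M b (T r k a) \<le> Lp_dist p M b (Lp_class p M g) + Lp_dist p M (Lp_class p M g) (T r k a)"
      by (rule triangle[OF b Lp_class_in_Lp[OF g_Lp] T_Lp[OF a(1)]])
    also have "\<dots> < \<delta>"
      using bg rk n by (simp add: commute)
    finally show "\<exists>c\<in>?orbit. Lp_dist p M b c < \<delta>"
      by (rule bexI) auto
  qed
  then show ?thesis
    unfolding real_supercyclic_def T_def using a(1) by (rule bexI)
qed

end

theorem theorem3p1:
  fixes M :: "'a :: {second_countable_topology, t2_space} measure"
    and f :: "'a \<Rightarrow> 'a"
    and p :: real
  assumes "1 \<le> p"
    and "composition_dynamical_system M f"
  shows "real_supercyclic (Lp p M) (Lp_dist p M) (Lp_scaleR p M) (Lp_comp p M f) \<longleftrightarrow>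
    (\<forall>\<epsilon>::real. \<forall>B. \<epsilon> > 0 \<longrightarrow> B \<in> sets M \<longrightarrow> emeasure M B < \<infinity> \<longrightarrow>
      (\<exists>B' k. \<exists>r::real. B' \<in> sets M \<and> B' \<subseteq> B \<and> k \<ge> (1::nat) \<and> r > 0 \<and>
        emeasure M (B - B') < ennreal \<epsilon> \<and>
        emeasure M ((f ^^ k) ` B') < ennreal (r powr p * \<epsilon>) \<and>
        emeasure M ((f ^^ k) -` B') < ennreal (r powr (- p) * \<epsilon>)))"
    (is "?cyclic \<longleftrightarrow> ?small")
proof
  interpret composition_dynamical_system M f by fact
  show ?small if ?cyclic
    by (intro allI impI) (rule real_supercyclic_imp_small_images[OF assms(1) that])
  show ?cyclic if ?small
  proof (rule transitive_imp_real_supercyclic[OF assms(1)], rule small_images_imp_transitive[OF assms(1)])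
    fix \<epsilon> :: real and B
    assume "\<epsilon> > 0" "B \<in> sets M" "emeasure M B < \<infinity>"
    from that[rule_format, OF this] show "\<exists>B' k. \<exists>r::real. B' \<in> sets M \<and> B' \<subseteq> B \<and> r > 0 \<and>
        emeasure M (B - B') < ennreal \<epsilon> \<and>
        emeasure M ((f ^^ k) ` B') < ennreal (r powr p * \<epsilon>) \<and>
        emeasure M ((f ^^ k) -` B') < ennreal (r powr (- p) * \<epsilon>)"
      by blast
  qed
qed

end
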